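(* Let $\mathbb{X}$ be a Banach space with a basis. If $\ell_1$ is isomorphic to a complemented subspace of $\mathbb{X}$, then $\mathbb{X}$ has an almost greedy basis $\mathcal{B}$ with $\phi_m[\mathcal{B}]\approx m$ for $m\in\mathbb{N}$ and $L_m[\mathcal{B}]\approx\log m$ for $m\ge 2$.
   Context: Banach spaces are real or complex and infinite-dimensional bases are Schauder bases. Let $\mathcal{B}=(\mathbf{x}_n)_{n=1}^\infty$ be a basis of $\mathbb{X}$ with coordinate functionals $(\mathbf{x}_n^* )_{n=1}^\infty$. For $A\subseteq\mathbb{N}$, the coordinate projection is $S_A[\mathcal{B}](f)=\sum_{n\in A}\mathbf{x}_n^*(f)\,\mathbf{x}_n$ (when well defined), and $\operatorname{supp}(f)=\{n:\mathbf{x}_n^*(f)\neq0\}$. The basis is almost greedy if there is a constant $C$ such that $\|f-S_A[\mathcal{B}](f)\|\le C\|f-S_B[\mathcal{B}](f)\|$ whenever $f\in\mathbb{X}$, $A,B\subseteq\mathbb{N}$, $|B|\le|A|<\infty$, and $|\mathbf{x}_j^*(f)|\le|\mathbf{x}_k^*(f)|$ for all $j\in\mathbb{N}\setminus A$ and $k\in A$. The fundamental function is $\phi_m[\mathcal{B}]=\sup_{|A|\le m}\|\sum_{j\in A}\mathbf{x}_j\|$. The w-conditionality constants are $$L_m[\mathcal{B}]=\sup\left\{\frac{\|S_A[\mathcal{B}](f)\|}{\|f\|}: f\ne0,\ \max(\operatorname{supp}(f))\le m,\ A\subseteq\mathbb{N}\right\}.$$ For families of nonnegative reals, $\alpha_i\lesssim\beta_i$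 means there is a constant $C$ with $\alpha_i\le C\beta_i$ for all $i$, and $\alpha_i\approx\beta_i$ means $\alpha_i\lesssim\beta_i$ and $\beta_i\lesssim\alpha_i$. *)

theory Defs
  imports "HOL-Analysis.Analysis"
begin

text \<open>
  The scalar field is a type \<open>'k\<close> of sort \<open>{real_normed_field, euclidean_space}\<close>. Both
  \<open>real\<close> and \<open>complex\<close> have this sort, and by Frobenius they are, up to isometric
  isomorphism, the only such fields. The scalar multiplication is an explicit argument because
  the library has no type class of complex normed spaces.
\<close>

locale normed_space_over = vector_space smul
  for smul :: "'k::{real_normed_field, euclidean_space} \<Rightarrow> 'a::real_normed_vector \<Rightarrow> 'a" +
  assumes norm_scale: "norm (smul c x) = norm c * norm x"
    and scale_of_real: "smul (of_real r) x = r *\<^sub>R x"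

lemma normed_space_over_scaleR:
  "normed_space_over (scaleR :: real \<Rightarrow> 'a::real_normed_vector \<Rightarrow> 'a)"
  by unfold_locales (simp_all add: algebra_simps)

lemma normed_space_over_complex:
  "normed_space_over ((*) :: complex \<Rightarrow> complex \<Rightarrow> complex)"
  by unfold_locales (simp_all add: algebra_simps norm_mult scaleR_conv_of_real)


text \<open>
  Bases are indexed from \<open>0\<close>: the vector \<open>x n\<close> is the one written with index \<open>n + 1\<close>
  when the natural numbers start at \<open>1\<close>.
\<close>

definition schauder_basis ::
  "('k \<Rightarrow> 'a \<Rightarrow> 'a) \<Rightarrow> (nat \<Rightarrow> 'a::real_normed_vector) \<Rightarrow> bool" where
  "schauder_basis smul x \<longleftrightarrow> (\<forall>f. \<exists>!c. (\<lambda>n. smul (c n) (x n)) sums f)"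

definition coord ::
  "('k \<Rightarrow> 'a \<Rightarrow> 'a) \<Rightarrow> (nat \<Rightarrow> 'a::real_normed_vector) \<Rightarrow> nat \<Rightarrow> 'a \<Rightarrow> 'k" where
  "coord smul x n f = (THE c. (\<lambda>n. smul (c n) (x n)) sums f) n"

lemma coord_sums:
  assumes "schauder_basis smul x"
  shows "(\<lambda>n. smul (coord smul x n f) (x n)) sums f"
  using theI'[of "\<lambda>c. (\<lambda>n. smul (c n) (x n)) sums f"] assms
  unfolding schauder_basis_def coord_def by blast

definition supp ::
  "('k::zero \<Rightarrow> 'a \<Rightarrow> 'a) \<Rightarrow> (nat \<Rightarrow> 'a::real_normed_vector) \<Rightarrow> 'a \<Rightarrow> nat set" where
  "supp smul x f = {n. coord smul x n f \<noteq> 0}"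

text \<open>Meaningful only if the series converges, e.g. if \<open>A\<close> or the support of \<open>f\<close> is finite.\<close>

definition coord_proj ::
  "('k \<Rightarrow> 'a \<Rightarrow> 'a) \<Rightarrow> (nat \<Rightarrow> 'a::real_normed_vector) \<Rightarrow> nat set \<Rightarrow> 'a \<Rightarrow> 'a" where
  "coord_proj smul x A f = (\<Sum>n. if n \<in> A then smul (coord smul x n f) (x n) else 0)"

lemma coord_proj_finite:
  assumes "finite A"
  shows "coord_proj smul x A f = (\<Sum>n\<in>A. smul (coord smul x n f) (x n))"
  unfolding coord_proj_def by (subst suminf_finite[OF assms]) auto

definition almost_greedy ::
  "('k::real_normed_vector \<Rightarrow> 'a \<Rightarrow> 'a) \<Rightarrow> (nat \<Rightarrow> 'a::real_normed_vector) \<Rightarrow> bool" where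
  "almost_greedy smul x \<longleftrightarrow>
    (\<exists>C::real. \<forall>f A B. finite A \<longrightarrow> finite B \<longrightarrow> card B \<le> card A \<longrightarrow>
      (\<forall>j\<in>-A. \<forall>k\<in>A. norm (coord smul x j f) \<le> norm (coord smul x k f)) \<longrightarrow>
      norm (f - coord_proj smul x A f) \<le> C * norm (f - coord_proj smul x B f))"


text \<open>
  The suprema are taken in \<^typ>\<open>ennreal\<close>, since the fundamental function of an unbounded basis
  is infinite.
\<close>

definition fundamental_function :: "(nat \<Rightarrow> 'a::real_normed_vector) \<Rightarrow> nat \<Rightarrow> ennreal" where
  "fundamental_function x m = Sup {ennreal (norm (\<Sum>j\<in>A. x j)) | A. finite A \<and> card A \<le> m}"

text \<open>
  With indices starting at \<open>0\<close>, the condition that the largest index in the support is at most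
  \<open>m\<close> becomes containment of the support in \<open>{..<m}\<close>.
\<close>

definition conditionality_const ::
  "('k::zero \<Rightarrow> 'a \<Rightarrow> 'a) \<Rightarrow> (nat \<Rightarrow> 'a::real_normed_vector) \<Rightarrow> nat \<Rightarrow> ennreal" where
  "conditionality_const smul x m =
    Sup {ennreal (norm (coord_proj smul x A f) / norm f) | A f.
      f \<noteq> 0 \<and> supp smul x f \<subseteq> {..<m}}"

text \<open>The constant is a real number, so a family dominated by a finite one is itself finite.\<close>

definition dominated_on :: "'i set \<Rightarrow> ('i \<Rightarrow> ennreal) \<Rightarrow> ('i \<Rightarrow> ennreal) \<Rightarrow> bool" where
  "dominated_on I \<alpha> \<beta> \<longleftrightarrow> (\<exists>C::real. \<forall>i\<in>I. \<alpha> i \<le> ennreal C * \<beta> i)"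

definition equivalent_on :: "'i set \<Rightarrow> ('i \<Rightarrow> ennreal) \<Rightarrow> ('i \<Rightarrow> ennreal) \<Rightarrow> bool" where
  "equivalent_on I \<alpha> \<beta> \<longleftrightarrow> dominated_on I \<alpha> \<beta> \<and> dominated_on I \<beta> \<alpha>"


definition ell1 :: "(nat \<Rightarrow> 'k::real_normed_vector) set" where
  "ell1 = {a. summable (\<lambda>n. norm (a n))}"

definition ell1_norm :: "(nat \<Rightarrow> 'k::real_normed_vector) \<Rightarrow> real" where
  "ell1_norm a = (\<Sum>n. norm (a n))"

definition ell1_isomorphic ::
  "('k::real_normed_field \<Rightarrow> 'a \<Rightarrow> 'a) \<Rightarrow> 'a::real_normed_vector set \<Rightarrow> bool" where
  "ell1_isomorphic smul Y \<longleftrightarrow>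
    (\<exists>T::(nat \<Rightarrow> 'k) \<Rightarrow> 'a.
      (\<forall>a\<in>ell1. \<forall>b\<in>ell1. T (\<lambda>n. a n + b n) = T a + T b) \<and>
      (\<forall>c. \<forall>a\<in>ell1. T (\<lambda>n. c * a n) = smul c (T a)) \<and>
      T ` ell1 = Y \<and>
      (\<exists>c>0. \<exists>C. \<forall>a\<in>ell1. c * ell1_norm a \<le> norm (T a) \<and> norm (T a) \<le> C * ell1_norm a))"

definition complemented_subspace ::
  "('k::field \<Rightarrow> 'a \<Rightarrow> 'a) \<Rightarrow> 'a::real_normed_vector set \<Rightarrow> bool" where
  "complemented_subspace smul Y \<longleftrightarrow>
    (\<exists>P. Vector_Spaces.linear smul smul P \<and> continuous_on UNIV P \<and> P \<circ> P = P \<and> range P = Y)"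

end

theory Submission
  imports Defs "HOL-Library.Discrete_Functions"
begin

text \<open>
  Write the space as \<open>Z \<oplus> \<ell>\<^sub>1\<close>. Since \<open>\<ell>\<^sub>1\<close> is isomorphic to
  \<open>\<ell>\<^sub>1 \<oplus> \<ell>\<^sub>1 \<oplus> \<ell>\<^sub>1\<close>, the space is isomorphic to its sum with two further copies of
  \<open>\<ell>\<^sub>1\<close>. The given basis is interleaved with the difference basis of the first new copy, whose
  conditionality constants grow linearly; call the result \<open>v\<close>. The second new copy, with unit vectors
  \<open>e\<close>, is combined with \<open>v\<close> by the method of Dilworth, Kalton and Kutzarova: indices are grouped into
  blocks of size \<open>2\<^sup>n\<close>, and each of the \<open>2\<^sup>n\<close> new basis vectors of block \<open>n\<close> is the sum of \<open>v n\<close> and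
  a unit vector minus the mean of the unit vectors of the block. The deviation of the coefficients from
  their block means is thus measured in \<open>\<ell>\<^sub>1\<close>, which makes the basis almost greedy with fundamental
  function \<open>m\<close>, while the block sums are measured by \<open>v\<close>. As the first \<open>m\<close> vectors meet only about
  \<open>log m\<close> blocks, the conditionality is that of the first \<open>log m\<close> vectors of \<open>v\<close>, hence of order \<open>log m\<close>.
\<close>

section \<open>Schauder bases and the basis constant\<close>

text \<open>\<open>bounded_linear\<close> only expresses linearity over the reals, so homogeneity
  over \<open>'k\<close> is required separately.\<close>

definition bounded_functional ::
  "('k::real_normed_field \<Rightarrow> 'a \<Rightarrow> 'a) \<Rightarrow> ('a::real_normed_vector \<Rightarrow> 'k) \<Rightarrow> bool" where
  "bounded_functional smul \<phi> \<longleftrightarrow> bounded_linear \<phi> \<and> (\<forall>c f. \<phi> (smul c f) = c * \<phi> f)"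

lemma bounded_functional_zero: "bounded_functional smul (\<lambda>f. 0)"
  unfolding bounded_functional_def by simp

lemma bounded_functional_add:
  "bounded_functional smul \<phi> \<Longrightarrow> bounded_functional smul \<psi> \<Longrightarrow>
    bounded_functional smul (\<lambda>f. \<phi> f + \<psi> f)"
  unfolding bounded_functional_def by (simp add: bounded_linear_add algebra_simps)

lemma bounded_functional_diff:
  "bounded_functional smul \<phi> \<Longrightarrow> bounded_functional smul \<psi> \<Longrightarrow>
    bounded_functional smul (\<lambda>f. \<phi> f - \<psi> f)"
  unfolding bounded_functional_def by (simp add: bounded_linear_sub algebra_simps)

lemma bounded_functional_sum:
  assumes "\<And>i. i \<in> I \<Longrightarrow> bounded_functional smul (\<phi> i)"
  shows "bounded_functional smul (\<lambda>f. \<Sum>i\<in>I. \<phi> i f)"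
  using assms unfolding bounded_functional_def by (auto intro!: bounded_linear_sum simp: sum_distrib_left)

lemma bounded_functional_cmult:
  assumes "bounded_functional smul \<phi>"
  shows "bounded_functional smul (\<lambda>f. c * \<phi> f)"
  using assms unfolding bounded_functional_def by (auto intro: bounded_linear_const_mult)

lemma bounded_functional_comp:
  assumes "bounded_functional smul \<phi>" "bounded_linear V" "\<And>c f. V (smul c f) = smul c (V f)"
  shows "bounded_functional smul (\<lambda>f. \<phi> (V f))"
  using assms unfolding bounded_functional_def by (auto intro: bounded_linear_compose)

section \<open>Bounded functionals and uniqueness of coordinates\<close>

context normed_space_over
begin

lemma bounded_bilinear_smul: "bounded_bilinear smul"
proof
  show "smul (r *\<^sub>R a) b = r *\<^sub>R smul a b" for r a b
    by (simp add: scaleR_conv_of_real scale_of_real flip: scale_scale)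
  show "smul a (r *\<^sub>R b) = r *\<^sub>R smul a b" for r a b
    by (metis scale_of_real scale_left_commute)
  show "\<exists>K. \<forall>a b. norm (smul a b) \<le> norm a * norm b * K"
    by (rule exI[of _ 1]) (simp add: norm_scale)
qed (simp_all add: scale_right_distrib scale_left_distrib)

lemma bounded_functional_of_bound:
  assumes "\<And>f g. \<phi> (f + g) = \<phi> f + \<phi> g" "\<And>c f. \<phi> (smul c f) = c * \<phi> f"
    and "\<And>f. norm (\<phi> f) \<le> K * norm f"
  shows "bounded_functional smul \<phi>"
  unfolding bounded_functional_def
proof (intro conjI allI)
  show "bounded_linear \<phi>"
  proof (rule bounded_linear_intro[where K=K])
    show "\<phi> (r *\<^sub>R x) = r *\<^sub>R \<phi> x" for r x
      by (metis assms(2) scale_of_real scaleR_conv_of_real)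
  qed (use assms in \<open>auto simp: mult.commute\<close>)
qed (rule assms)

lemma bounded_functional_sums:
  assumes "bounded_functional smul \<phi>" "(\<lambda>n. smul (c n) (x n)) sums f"
  shows "(\<lambda>n. c n * \<phi> (x n)) sums \<phi> f"
  using bounded_linear.sums[OF _ assms(2), of \<phi>] assms(1)
  by (simp add: bounded_functional_def)

lemma norm_sum_smul_le:
  assumes "\<And>k. k \<in> F \<Longrightarrow> norm (b k) \<le> B"
  shows "norm (\<Sum>k\<in>F. smul (c k) (b k)) \<le> B * (\<Sum>k\<in>F. norm (c k))"
proof -
  have "norm (\<Sum>k\<in>F. smul (c k) (b k)) \<le> (\<Sum>k\<in>F. norm (c k) * B)"
    by (rule sum_norm_le) (simp add: norm_scale assms mult_left_mono)
  then show ?thesis by (simp add: sum_distrib_left mult.commute)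
qed

text \<open>Continuous functionals can be applied to an expansion term by term, so biorthogonality
  reads off the coefficients of any expansion and forces uniqueness.\<close>

lemma schauder_basisI:
  assumes "\<And>n. bounded_functional smul (\<phi> n)"
    and "\<And>n m. \<phi> n (x m) = (if n = m then 1 else 0)"
    and "\<And>f. (\<lambda>n. smul (\<phi> n f) (x n)) sums f"
  shows "schauder_basis smul x" and "coord smul x n f = \<phi> n f"
proof -
  have uniq: "c = (\<lambda>n. \<phi> n f)" if "(\<lambda>n. smul (c n) (x n)) sums f" for c f
  proof
    fix n
    have "(\<lambda>m. c m * \<phi> n (x m)) sums \<phi> n f"
      using bounded_functional_sums[OF assms(1) that] .
    moreover have "(\<lambda>m. c m * \<phi> n (x m)) = (\<lambda>m. if m = n then c m else 0)"
      by (auto simp: assms(2))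
    ultimately show "c n = \<phi> n f"
      using sums_unique2 sums_single[of n c] by fastforce
  qed
  show "schauder_basis smul x"
    unfolding schauder_basis_def by (intro allI ex1I[of _ "\<lambda>n. \<phi> n _"]) (use uniq assms(3) in auto)
  have "(THE c. (\<lambda>n. smul (c n) (x n)) sums f) = (\<lambda>n. \<phi> n f)"
    by (rule the_equality) (use uniq assms(3) in auto)
  then show "coord smul x n f = \<phi> n f" by (simp add: coord_def)
qed

lemma coord_unique:
  assumes "schauder_basis smul x" "(\<lambda>n. smul (c n) (x n)) sums f"
  shows "coord smul x n f = c n"
  using assms coord_sums[OF assms(1), of f] unfolding schauder_basis_def by metis

lemma coord_diff:
  assumes "schauder_basis smul x"
  shows "coord smul x n (f - g) = coord smul x n f - coord smul x n g"
  by (rule coord_unique[OF assms])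
     (simp add: scale_left_diff_distrib sums_diff coord_sums[OF assms])

lemma coord_scale:
  assumes "schauder_basis smul x"
  shows "coord smul x n (smul a f) = a * coord smul x n f"
proof (rule coord_unique[OF assms])
  have "(\<lambda>n. smul a (smul (coord smul x n f) (x n))) sums smul a f"
    using bounded_linear.sums[OF bounded_bilinear.bounded_linear_right[OF bounded_bilinear_smul]]
      coord_sums[OF assms] .
  then show "(\<lambda>n. smul (a * coord smul x n f) (x n)) sums smul a f" by simp
qed

lemma schauder_basis_nonzero:
  assumes "schauder_basis smul x"
  shows "x n \<noteq> 0"
proof
  assume "x n = 0"
  then have "(\<lambda>m. smul (if m = n then 1 else 0) (x m)) = (\<lambda>m. 0)" by auto
  then have "(\<lambda>m. smul (if m = n then 1 else 0) (x m)) sums 0" by simp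
  from coord_unique[OF assms this, of n] coord_unique[OF assms, of "\<lambda>m. 0" 0 n]
  show False by simp
qed

end

text \<open>Closures appear because the sets to which this is applied, given by bounds on all
  partial sums, are not known to be closed before the coordinates are known to be
  continuous.\<close>

lemma baire_cover:
  fixes S :: "nat \<Rightarrow> 'a::banach set"
  assumes "(\<Union>n. S n) = UNIV"
  obtains n a r where "r > 0" "ball a r \<subseteq> closure (S n)"
proof -
  have "\<exists>n. interior (closure (S n)) \<noteq> {}"
  proof (rule ccontr)
    assume "\<not> ?thesis"
    then have e: "interior (closure (S n)) = {}" for n by blast
    have "Met_TC.mtopology interior_of \<Union>(range (\<lambda>n. closure (S n))) = {}"
    proof (rule Met_TC.metric_Baire_category_alt)
      show "Met_TC.mcomplete TYPE('a)"
        unfolding mcomplete_iff_complete by (rule complete_UNIV)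
      fix T assume "T \<in> range (\<lambda>n. closure (S n))"
      then show "closedin Met_TC.mtopology T \<and> Met_TC.mtopology interior_of T = {}"
        using e by auto
    qed simp
    moreover have "(\<Union>n. S n) \<subseteq> \<Union>(range (\<lambda>n. closure (S n)))"
      using closure_subset by (intro UN_mono) auto
    then have "\<Union>(range (\<lambda>n. closure (S n))) = UNIV" unfolding assms by blast
    ultimately show False by simp
  qed
  then obtain n a where "a \<in> interior (closure (S n))" by auto
  then show thesis using that unfolding mem_interior by blast
qed

section \<open>Uniform boundedness of the partial sum projections\<close>

locale banach_space_over = normed_space_over smul
  for smul :: "'k::{real_normed_field, euclidean_space} \<Rightarrow> 'a::banach \<Rightarrow> 'a"
begin

text \<open>
  The open mapping argument: by Baire, vectors with small partial sums are dense in a ball, and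
  a vector is then written as a series of such vectors whose partial sums decay geometrically.
\<close>

lemma basis_partial_sums_bounded:
  assumes x: "schauder_basis smul x"
  obtains K where "K > 0" "\<And>N f. norm (\<Sum>n<N. smul (coord smul x n f) (x n)) \<le> K * norm f"
proof -
  define S where "S N f = (\<Sum>n<N. smul (coord smul x n f) (x n))" for N f
  have S_diff: "S N (f - g) = S N f - S N g" for N f g
    unfolding S_def by (simp add: coord_diff[OF x] scale_left_diff_distrib sum_subtractf)
  have S_scale: "S N (smul c f) = smul c (S N f)" for N c f
    unfolding S_def by (simp add: coord_scale[OF x] scale_sum_right)
  have S_lim: "(\<lambda>N. S N f) \<longlonglongrightarrow> f" for f
    using coord_sums[OF x, of f] unfolding S_def sums_def .
  define A where "A k = {f. \<forall>N. norm (S N f) \<le> real k}" for k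
  have "(\<Union>k. A k) = UNIV"
  proof (intro equalityI subsetI UNIV_I)
    fix f
    have "Bseq (\<lambda>N. S N f)" using S_lim convergent_imp_Bseq convergent_def by blast
    then obtain B where "\<And>N. norm (S N f) \<le> B" by (auto simp: Bseq_def)
    then have "f \<in> A (nat \<lceil>B\<rceil>)"
      unfolding A_def by (auto intro: order_trans real_nat_ceiling_ge)
    then show "f \<in> (\<Union>k. A k)" by blast
  qed
  then obtain k a r where r: "r > 0" and ball: "ball a r \<subseteq> closure (A k)"
    by (rule baire_cover)
  define C where "C = 4 * real k / r"
  have "C \<ge> 0" using r by (simp add: C_def)
  \<comment> \<open>Approximating \<open>a + g\<close> and \<open>a\<close> from \<open>A k\<close>
    and subtracting moves the ball to the origin; the two bounds \<open>k\<close> add up to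
    \<open>2 * k\<close>.\<close>
  have small: "\<exists>h. norm (g - h) < d \<and> (\<forall>N. norm (S N h) \<le> 2 * real k)"
    if g: "norm g < r" and d: "d > 0" for g d
  proof -
    have "a + g \<in> closure (A k)" "a \<in> closure (A k)"
      using g r ball by (auto simp: dist_norm subset_eq)
    then obtain p q where p: "p \<in> A k" "dist p (a + g) < d / 2"
      and q: "q \<in> A k" "dist q a < d / 2"
      using d unfolding closure_approachable by (meson half_gt_zero)
    have "g - (p - q) = (q - a) - (p - (a + g))" by simp
    then have "norm (g - (p - q)) \<le> norm (q - a) + norm (p - (a + g))"
      by (metis norm_triangle_ineq4)
    then have "norm (g - (p - q)) < d" using p(2) q(2) by (simp add: dist_norm)
    moreover have "norm (S N (p - q)) \<le> 2 * real k" for N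
    proof -
      have "norm (S N (p - q)) \<le> norm (S N p) + norm (S N q)"
        by (simp add: S_diff norm_triangle_ineq4)
      moreover have "norm (S N p) \<le> real k" "norm (S N q) \<le> real k"
        using p(1) q(1) by (auto simp: A_def)
      ultimately show ?thesis by simp
    qed
    ultimately show ?thesis by blast
  qed
  have "\<exists>h. norm (g - h) \<le> norm g / 2 \<and> (\<forall>N. norm (S N h) \<le> C * norm g)" for g
  proof (cases "g = 0")
    case True
    have "S N 0 = 0" for N using S_diff[of N 0 0] by simp
    then show ?thesis using True by (intro exI[of _ 0]) auto
  next
    case False
    \<comment> \<open>Rescaling \<open>g\<close> to norm \<open>r / 2\<close> turns the error
      \<open>r / 4\<close> into half the norm of \<open>g\<close>, and the bound
      \<open>2 * k\<close> into \<open>C * norm g\<close>.\<close>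
    define t where "t = r / (2 * norm g)"
    have t: "t > 0" using False r by (simp add: t_def)
    have "norm (t *\<^sub>R g) < r" using False r by (simp add: t_def)
    from small[OF this, of "r / 4"] r obtain h where
      h: "norm (t *\<^sub>R g - h) < r / 4" "\<And>N. norm (S N h) \<le> 2 * real k"
      by auto
    define h' where "h' = (1 / t) *\<^sub>R h"
    have h'_smul: "h' = smul (of_real (1 / t)) h" unfolding h'_def scale_of_real ..
    have "g - h' = (1 / t) *\<^sub>R (t *\<^sub>R g - h)"
      using t by (simp add: h'_def scaleR_diff_right)
    then have "norm (g - h') = norm (t *\<^sub>R g - h) / t" using t by simp
    also have "\<dots> \<le> (r / 4) / t" using h(1) t by (intro divide_right_mono) auto
    also have "\<dots> = norm g / 2" using r False by (simp add: t_def)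
    finally have "norm (g - h') \<le> norm g / 2" .
    moreover have "norm (S N h') \<le> C * norm g" for N
    proof -
      have "norm (S N h') = norm (S N h) / t"
        using t unfolding h'_smul S_scale norm_scale by (simp add: norm_divide)
      also have "\<dots> \<le> (2 * real k) / t" using h(2) t by (intro divide_right_mono) auto
      also have "\<dots> = C * norm g" using r False by (simp add: t_def C_def)
      finally show ?thesis .
    qed
    ultimately show ?thesis by blast
  qed
  then obtain H where H: "\<And>g. norm (g - H g) \<le> norm g / 2"
    "\<And>g N. norm (S N (H g)) \<le> C * norm g" by metis
  have bound: "norm (S N f) \<le> 2 * C * norm f" for N f
  proof -
    \<comment> \<open>\<open>h i\<close> approximates the remainder \<open>g i\<close>. Norms of
      remainders at least halve in each step, so \<open>f\<close> is the sum of the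
      \<open>h i\<close>, whose partial sums obey geometric bounds.\<close>
    define g where "g i = ((\<lambda>g. g - H g) ^^ i) f" for i
    define h where "h i = H (g i)" for i
    have g_0: "g 0 = f" and g_Suc: "g (Suc i) = g i - h i" for i
      by (simp_all add: g_def h_def)
    have g_norm: "norm (g i) \<le> norm f * (1 / 2) ^ i" for i
    proof (induction i)
      case (Suc i)
      then show ?case using H(1)[of "g i"] by (simp add: g_Suc h_def)
    qed (simp add: g_0)
    define D where "D = C * norm f"
    have Sh: "norm (S N (h i)) \<le> D * (1 / 2) ^ i" for N i
    proof -
      have "norm (S N (h i)) \<le> C * norm (g i)" using H(2) by (simp add: h_def)
      also have "\<dots> \<le> C * (norm f * (1 / 2) ^ i)"
        using g_norm \<open>C \<ge> 0\<close> by (intro mult_left_mono)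
      finally show ?thesis by (simp add: D_def)
    qed
    have geo: "(\<lambda>i. D * (1 / 2) ^ i) sums (2 * D)"
      using sums_mult[OF geometric_sums[of "1/2::real"], of D] by (simp add: mult.commute)
    have h_norm: "norm (h i) \<le> D * (1 / 2) ^ i" for i
      using S_lim[of "h i"] Sh by (intro Lim_bounded[OF tendsto_norm]) auto
    have sum_h: "(\<Sum>i<m. h i) = f - g m" for m
      by (induction m) (simp_all add: g_0 g_Suc)
    have "g \<longlonglongrightarrow> 0"
    proof (rule Lim_null_comparison)
      show "(\<lambda>i. norm f * (1 / 2) ^ i) \<longlonglongrightarrow> 0"
        by (intro tendsto_mult_right_zero LIMSEQ_power_zero) auto
    qed (use g_norm in auto)
    then have h_sums: "h sums f"
      unfolding sums_def sum_h using tendsto_diff[OF tendsto_const] by fastforce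
    define c where "c n = (\<Sum>i. coord smul x n (h i))" for n
    have coord_h: "norm (coord smul x n (h i)) \<le> (2 * D / norm (x n)) * (1 / 2) ^ i" for n i
    proof -
      have "norm (x n) > 0" using schauder_basis_nonzero[OF x] by simp
      have "smul (coord smul x n (h i)) (x n) = S (Suc n) (h i) - S n (h i)"
        by (simp add: S_def)
      then have "norm (coord smul x n (h i)) * norm (x n) \<le> norm (S (Suc n) (h i)) + norm (S n (h i))"
        by (metis norm_scale norm_triangle_ineq4)
      also have "\<dots> \<le> 2 * D * (1 / 2) ^ i" using Sh[of "Suc n" i] Sh[of n i] by simp
      finally show ?thesis using \<open>norm (x n) > 0\<close> by (simp add: field_simps)
    qed
    have c_sums: "(\<lambda>i. coord smul x n (h i)) sums c n" for n
      unfolding c_def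
      by (rule summable_sums, rule summable_comparison_test'[OF _ coord_h])
         (intro summable_mult summable_geometric, simp)
    have sum_c: "(\<lambda>i. S N (h i)) sums (\<Sum>n<N. smul (c n) (x n))" for N
      unfolding S_def
      by (intro sums_sum bounded_linear.sums[OF _ c_sums])
         (rule bounded_bilinear.bounded_linear_left[OF bounded_bilinear_smul])
    have "(\<lambda>n. smul (c n) (x n)) sums f"
      unfolding sums_def
    proof (rule LIM_zero_cancel, rule Lim_null_comparison)
      have small2: "norm (h i - S N (h i)) \<le> 2 * D * (1 / 2) ^ i" for N i
        using norm_triangle_ineq4[of "h i" "S N (h i)"] h_norm[of i] Sh[of N i] by simp
      have sm: "summable (\<lambda>i. 2 * D * (1 / 2) ^ i)"
        by (intro summable_mult summable_geometric) simp
      \<comment> \<open>Tannery's theorem exchanges the limit in \<open>N\<close> with the sum over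
        \<open>i\<close>; \<open>small2\<close> supplies the dominating geometric series.\<close>
      have "eventually (\<lambda>N. summable (\<lambda>i. norm (norm (h i - S N (h i))))) sequentially \<and>
          summable (\<lambda>n. norm (0::real)) \<and>
          ((\<lambda>N. suminf (\<lambda>i. norm (h i - S N (h i)))) \<longlonglongrightarrow> suminf (\<lambda>i. 0 :: real))"
      proof (rule tannerys_theorem[OF _ _ sm])
        show "((\<lambda>N. norm (h i - S N (h i))) \<longlongrightarrow> 0) sequentially" for i
          using tendsto_norm[OF tendsto_diff[OF tendsto_const S_lim[of "h i"], of "h i"]] by simp
      qed (use small2 in \<open>auto intro!: always_eventually\<close>)
      then show "(\<lambda>N. \<Sum>i. norm (h i - S N (h i))) \<longlonglongrightarrow> 0" by simp
      have sm': "summable (\<lambda>i. norm (h i - S N (h i)))" for N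
        by (rule summable_comparison_test'[OF sm, of 0]) (simp add: small2)
      show "\<forall>\<^sub>F N in sequentially. norm ((\<Sum>n<N. smul (c n) (x n)) - f)
          \<le> (\<Sum>i. norm (h i - S N (h i)))"
      proof (rule always_eventually, rule allI)
        fix N
        have "(\<lambda>i. h i - S N (h i)) sums (f - (\<Sum>n<N. smul (c n) (x n)))"
          using sums_diff[OF h_sums sum_c] .
        then show "norm ((\<Sum>n<N. smul (c n) (x n)) - f) \<le> (\<Sum>i. norm (h i - S N (h i)))"
          using summable_norm[OF sm', of N] by (simp add: sums_iff norm_minus_commute)
      qed
    qed
    then have "coord smul x n f = c n" for n by (rule coord_unique[OF x])
    then have "(\<lambda>i. S N (h i)) sums S N f" using sum_c[of N] by (simp add: S_def)
    then have "norm (S N f) \<le> (\<Sum>i. D * (1 / 2) ^ i)"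
      using Sh geo by (metis sums_iff norm_suminf_le)
    then show ?thesis using geo by (simp add: sums_iff D_def)
  qed
  show thesis
  \<comment> \<open>The summand 1 makes the constant positive even if \<open>C = 0\<close>.\<close>
  proof (rule that[of "2 * C + 1"])
    show "norm (\<Sum>n<N. smul (coord smul x n f) (x n)) \<le> (2 * C + 1) * norm f" for N f
      using add_increasing2[OF norm_ge_zero bound[of N f], of f]
      unfolding S_def by (simp add: distrib_right)
  qed (use \<open>C \<ge> 0\<close> in simp)
qed

end

section \<open>Complemented copies of \<open>\<ell>\<^sub>1\<close>\<close>

context banach_space_over
begin

lemma coord_basis:
  assumes "schauder_basis smul x"
  shows "coord smul x n (x m) = (if n = m then 1 else 0)"
proof (rule coord_unique[OF assms])
  have "(\<lambda>n. smul (if n = m then 1 else 0) (x n)) = (\<lambda>n. if n = m then x n else 0)" by auto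
  then show "(\<lambda>n. smul (if n = m then 1 else 0) (x n)) sums x m" using sums_single[of m x] by simp
qed

lemma coord_add:
  assumes "schauder_basis smul x"
  shows "coord smul x n (f + g) = coord smul x n f + coord smul x n g"
  by (rule coord_unique[OF assms])
     (simp add: scale_left_distrib sums_add coord_sums[OF assms])

text \<open>Equivalently, sending \<open>f\<close> to the sequence of the \<open>t n f\<close> is a
  bounded operator into l1 of norm at most \<open>K\<close>.\<close>

definition ell1_functionals :: "(nat \<Rightarrow> 'a \<Rightarrow> 'k) \<Rightarrow> real \<Rightarrow> bool" where
  "ell1_functionals t K \<longleftrightarrow> (\<forall>n. bounded_functional smul (t n)) \<and>
    (\<forall>f. summable (\<lambda>n. norm (t n f)) \<and> (\<Sum>n. norm (t n f)) \<le> K * norm f)"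

text \<open>The operator into l1 given by \<open>t\<close>, followed by the operator out of l1 that
  maps the unit vectors to the \<open>b n\<close>.\<close>

definition ell1_synthesis :: "(nat \<Rightarrow> 'a \<Rightarrow> 'k) \<Rightarrow> (nat \<Rightarrow> 'a) \<Rightarrow> 'a \<Rightarrow> 'a" where
  "ell1_synthesis t b f = (\<Sum>n. smul (t n f) (b n))"

lemma ell1_functionals_reindex:
  assumes t: "ell1_functionals t K" and g: "strict_mono g"
  shows "ell1_functionals (\<lambda>n. t (g n)) K"
proof -
  have "summable (\<lambda>n. norm (t (g n) f)) \<and> (\<Sum>n. norm (t (g n) f)) \<le> K * norm f" for f
  proof -
    define r where "r m = (if m \<in> range g then norm (t m f) else 0)" for m
    have sm: "summable (\<lambda>n. norm (t n f))" using t by (simp add: ell1_functionals_def)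
    have r: "summable r"
      by (rule summable_comparison_test'[OF sm, of 0]) (simp add: r_def)
    have r_g: "(\<lambda>n. norm (t (g n) f)) = (\<lambda>n. r (g n))" by (simp add: r_def)
    have z: "r n = 0" if "n \<notin> range g" for n using that by (simp add: r_def)
    have "suminf r \<le> (\<Sum>n. norm (t n f))"
      by (rule suminf_le[OF _ r sm]) (simp add: r_def)
    moreover have "(\<Sum>n. norm (t n f)) \<le> K * norm f"
      using t by (simp add: ell1_functionals_def)
    moreover have "summable (\<lambda>n. r (g n))" "(\<Sum>n. r (g n)) = suminf r"
      using summable_mono_reindex[of g r, OF g z] suminf_mono_reindex[of g r, OF g z] r by blast+
    ultimately show ?thesis unfolding r_g by simp
  qed
  then show ?thesis using t by (simp add: ell1_functionals_def)
qed

context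
  fixes t :: "nat \<Rightarrow> 'a \<Rightarrow> 'k" and K :: real and b :: "nat \<Rightarrow> 'a" and B :: real
  assumes t: "ell1_functionals t K" and b: "\<And>n. norm (b n) \<le> B"
begin

lemma ell1_synthesis_sums: "(\<lambda>n. smul (t n f) (b n)) sums ell1_synthesis t b f"
  unfolding ell1_synthesis_def
proof (rule summable_sums, rule summable_comparison_test')
  show "summable (\<lambda>n. norm (t n f) * B)"
    using t by (intro summable_mult2) (simp add: ell1_functionals_def)
  show "norm (smul (t n f) (b n)) \<le> norm (t n f) * B" for n
    by (simp add: norm_scale b mult_left_mono)
qed

lemma ell1_synthesis_norm: "norm (ell1_synthesis t b f) \<le> B * K * norm f"
proof -
  have "B \<ge> 0" using b[of 0] norm_ge_zero order_trans by blast
  have sm: "summable (\<lambda>n. norm (t n f))" and le: "(\<Sum>n. norm (t n f)) \<le> K * norm f"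
    using t by (auto simp: ell1_functionals_def)
  have "norm (ell1_synthesis t b f) \<le> (\<Sum>n. norm (t n f) * B)"
    unfolding ell1_synthesis_def
    by (rule norm_suminf_le) (simp_all add: norm_scale b mult_left_mono summable_mult2 sm)
  also have "\<dots> = (\<Sum>n. norm (t n f)) * B" using suminf_mult2[OF sm, of B] by simp
  also have "\<dots> \<le> (K * norm f) * B" using le \<open>B \<ge> 0\<close> by (rule mult_right_mono)
  finally show ?thesis by (simp add: mult_ac)
qed

lemma ell1_synthesis_scale: "ell1_synthesis t b (smul c f) = smul c (ell1_synthesis t b f)"
proof -
  have "(\<lambda>n. smul c (smul (t n f) (b n))) sums smul c (ell1_synthesis t b f)"
    by (rule bounded_linear.sums[OF bounded_bilinear.bounded_linear_right[OF bounded_bilinear_smul]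
          ell1_synthesis_sums])
  then show ?thesis
    using t ell1_synthesis_sums[of "smul c f"]
    by (simp add: ell1_functionals_def bounded_functional_def sums_unique2)
qed

lemma bounded_linear_ell1_synthesis: "bounded_linear (ell1_synthesis t b)"
proof (rule bounded_linear_intro[where K="B * K"])
  fix f g :: 'a and r :: real
  have "(\<lambda>n. smul (t n f) (b n) + smul (t n g) (b n)) sums
      (ell1_synthesis t b f + ell1_synthesis t b g)"
    by (intro sums_add ell1_synthesis_sums)
  moreover have "t n (f + g) = t n f + t n g" for n
    using t by (simp add: ell1_functionals_def bounded_functional_def linear_simps)
  ultimately show "ell1_synthesis t b (f + g) = ell1_synthesis t b f + ell1_synthesis t b g"
    using ell1_synthesis_sums[of "f + g"] by (simp add: scale_left_distrib sums_unique2)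
  show "ell1_synthesis t b (r *\<^sub>R f) = r *\<^sub>R ell1_synthesis t b f"
    using ell1_synthesis_scale[of "of_real r" f] by (simp add: scale_of_real)
  show "norm (ell1_synthesis t b f) \<le> norm f * (B * K)"
    using ell1_synthesis_norm[of f] by (simp add: mult_ac)
qed

lemma functional_ell1_synthesis:
  assumes "bounded_functional smul \<phi>"
  shows "(\<lambda>n. t n f * \<phi> (b n)) sums \<phi> (ell1_synthesis t b f)"
  by (rule bounded_functional_sums[OF assms ell1_synthesis_sums])

lemma functional_ell1_synthesis_single:
  assumes "bounded_functional smul \<phi>" "\<And>n. n \<noteq> m \<Longrightarrow> \<phi> (b n) = 0"
  shows "\<phi> (ell1_synthesis t b f) = t m f * \<phi> (b m)"
proof -
  have "(\<lambda>n. t n f * \<phi> (b n)) = (\<lambda>n. if n = m then t m f * \<phi> (b m) else 0)"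
    using assms(2) by auto
  then show ?thesis
    using functional_ell1_synthesis[OF assms(1), of f] sums_single[of m "\<lambda>_. t m f * \<phi> (b m)"]
    by (simp add: sums_unique2)
qed

end

section \<open>Biorthogonal functionals on a complemented copy of l1\<close>

lemma continuous_linear_bounded:
  assumes "Vector_Spaces.linear smul smul P" "continuous_on UNIV P"
  obtains B where "B > 0" "\<And>f. norm (P f) \<le> B * norm f"
proof -
  interpret P: Vector_Spaces.linear smul smul P by fact
  have "isCont P 0" using assms(2) continuous_on_eq_continuous_at[OF open_UNIV, of P] by simp
  then obtain d where "d > 0" "\<forall>f. dist f 0 < d \<longrightarrow> dist (P f) (P 0) < 1"
    unfolding continuous_at_eps_delta by (meson zero_less_one)
  then have d: "d > 0" "\<And>f. norm f < d \<Longrightarrow> norm (P f) < 1"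
    by (simp_all add: P.zero)
  have "norm (P f) \<le> (2 / d) * norm f" for f
  proof (cases "f = 0")
    case False
    define r where "r = d / (2 * norm f)"
    have r: "r > 0" using False d by (simp add: r_def)
    have "norm (smul (of_real r) f) = r * norm f" using r by (simp add: norm_scale)
    also have "\<dots> < d" using d False by (simp add: r_def)
    finally have "norm (smul (of_real r) f) < d" .
    then have "norm (smul (of_real r) (P f)) < 1" using d(2) by (simp flip: P.scale)
    then have "r * norm (P f) < 1" using r by (simp add: norm_scale)
    then show ?thesis using False d by (simp add: r_def field_simps)
  qed (simp add: P.zero)
  then show thesis using that[of "2 / d"] d by simp
qed

text \<open>With \<open>P\<close> the projection and \<open>T\<close> the isomorphism,
  \<open>u n\<close> is the image of a unit vector and \<open>t n f\<close> is coordinate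
  \<open>n\<close> of the preimage of \<open>P f\<close>. The lower bound for \<open>T\<close> and
  the continuity of \<open>P\<close> make \<open>t\<close> bounded into l1; biorthogonality holds
  because \<open>P\<close> fixes its range.\<close>

lemma complemented_ell1_basis:
  assumes "complemented_subspace smul Y" "ell1_isomorphic smul Y"
  obtains u t K where "K > 0" "ell1_functionals t K" "\<And>n. norm (u n) \<le> K"
    "\<And>n m. t n (u m) = (if n = m then 1 else 0)"
proof -
  obtain P where P: "Vector_Spaces.linear smul smul P" "continuous_on UNIV P" "P \<circ> P = P"
    "range P = Y"
    using assms(1) unfolding complemented_subspace_def by blast
  interpret P: Vector_Spaces.linear smul smul P by fact
  from assms(2)[unfolded ell1_isomorphic_def] obtain T :: "(nat \<Rightarrow> 'k) \<Rightarrow> 'a" where T: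
    "(\<forall>a\<in>ell1. \<forall>b\<in>ell1. T (\<lambda>n. a n + b n) = T a + T b) \<and>
      (\<forall>r. \<forall>a\<in>ell1. T (\<lambda>n. r * a n) = smul r (T a)) \<and> T ` ell1 = Y \<and>
      (\<exists>c>0. \<exists>C. \<forall>a\<in>ell1. c * ell1_norm a \<le> norm (T a) \<and> norm (T a) \<le> C * ell1_norm a)"
    by (rule exE)
  note T_add = bspec[OF bspec[OF conjunct1[OF T]]]
  note T_scale = bspec[OF spec[OF conjunct1[OF conjunct2[OF T]]]]
  note T_ran = conjunct1[OF conjunct2[OF conjunct2[OF T]]]
  from conjunct2[OF conjunct2[OF conjunct2[OF T]]] obtain c C where c: "c > 0" and
    "\<forall>a\<in>ell1. c * ell1_norm a \<le> norm (T a) \<and> norm (T a) \<le> C * ell1_norm a"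
    by blast
  then have T_norm: "c * ell1_norm a \<le> norm (T a) \<and> norm (T a) \<le> C * ell1_norm a"
    if "a \<in> ell1" for a using that by blast
  obtain B where B: "B > 0" "\<And>f. norm (P f) \<le> B * norm f"
    using continuous_linear_bounded[OF P(1,2)] by blast
  have ell1_add: "(\<lambda>n. a n + b n) \<in> ell1" if "a \<in> ell1" "b \<in> ell1" for a b :: "nat \<Rightarrow> 'k"
  proof -
    have "summable (\<lambda>n. norm (a n) + norm (b n))"
      using that by (intro summable_add) (simp_all add: ell1_def)
    then have "summable (\<lambda>n. norm (a n + b n))"
      by (rule summable_comparison_test'[where N=0]) (simp add: norm_triangle_ineq)
    then show ?thesis by (simp add: ell1_def)
  qed
  have ell1_scale: "(\<lambda>n. r * a n) \<in> ell1" if "a \<in> ell1" for r and a :: "nat \<Rightarrow> 'k"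
    using that by (simp add: ell1_def norm_mult summable_mult)
  have T_inj: "a = b" if ab: "a \<in> ell1" "b \<in> ell1" "T a = T b" for a b
  proof -
    define d where "d = (\<lambda>n. a n + (- 1) * b n)"
    have d: "d \<in> ell1" unfolding d_def by (intro ell1_add ell1_scale ab)
    have "T d = 0" unfolding d_def using ab by (simp only: T_add T_scale ell1_scale) simp
    then have "c * ell1_norm d \<le> 0" using T_norm[OF d] by simp
    then have "(\<Sum>n. norm (d n)) \<le> 0" using c by (simp add: ell1_norm_def mult_le_0_iff)
    moreover have "summable (\<lambda>n. norm (d n))" using d by (simp add: ell1_def)
    ultimately have "\<forall>n. norm (d n) = 0"
      using suminf_eq_zero_iff[of "\<lambda>n. norm (d n)"] suminf_nonneg[of "\<lambda>n. norm (d n)"] by simp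
    then show "a = b" by (auto simp: d_def)
  qed
  have "\<exists>a\<in>ell1. T a = P f" for f using P(4) T_ran by (metis imageE rangeI)
  then obtain A where A: "\<And>f. A f \<in> ell1" "\<And>f. T (A f) = P f" by metis
  have A_eq: "A f = a" if "a \<in> ell1" "T a = P f" for f a
    using T_inj that A by simp
  define t where "t n f = A f n" for n f
  define \<delta> :: "nat \<Rightarrow> nat \<Rightarrow> 'k" where "\<delta> m = (\<lambda>n. if n = m then 1 else 0)" for m
  have \<delta>_sums: "(\<lambda>n. norm (\<delta> m n)) sums 1" for m
    using sums_single[of m "\<lambda>_. 1::real"] by (simp add: \<delta>_def if_distrib cong: if_cong)
  have \<delta>: "\<delta> m \<in> ell1" "ell1_norm (\<delta> m) = 1" for m
    using \<delta>_sums[of m] by (auto simp: ell1_def ell1_norm_def sums_iff)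
  define u where "u m = T (\<delta> m)" for m
  have A_add: "A (f + g) = (\<lambda>n. A f n + A g n)" for f g
    by (rule A_eq) (simp_all add: ell1_add A T_add P.add)
  have A_scale: "A (smul r f) = (\<lambda>n. r * A f n)" for r f
    by (rule A_eq) (simp_all add: ell1_scale A T_scale P.scale)
  have t_sum: "summable (\<lambda>n. norm (t n f))" for f
    using A(1)[of f] by (simp add: t_def ell1_def)
  have t_le: "(\<Sum>n. norm (t n f)) \<le> (B / c) * norm f" for f
  proof -
    have "c * ell1_norm (A f) \<le> B * norm f" using T_norm[OF A(1)] B A by (metis order_trans)
    then show ?thesis using c by (simp add: t_def ell1_norm_def field_simps)
  qed
  have t_norm: "norm (t n f) \<le> (B / c) * norm f" for n f
    using sum_le_suminf[OF t_sum, of "{n}" f] t_le[of f] by simp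
  define K where "K = B / c + \<bar>C\<bar>"
  show thesis
  proof (rule that)
    show "K > 0" using B c by (simp add: K_def add_pos_nonneg)
    have "(B / c) * norm f \<le> K * norm f" for f
      by (rule mult_right_mono) (simp_all add: K_def)
    moreover have "bounded_functional smul (t n)" for n
      by (rule bounded_functional_of_bound[OF _ _ t_norm]) (simp_all add: t_def A_add A_scale)
    ultimately show "ell1_functionals t K"
      unfolding ell1_functionals_def using t_sum t_le order_trans by blast
    have "norm (u n) \<le> C" for n using T_norm[OF \<delta>(1)] \<delta>(2) by (simp add: u_def)
    then show "norm (u n) \<le> K" for n
      using B c unfolding K_def by (smt (verit) abs_ge_self divide_nonneg_pos)
    have "P (u m) = u m" for m
    proof -
      have "u m \<in> range P" using P(4) T_ran \<delta> by (auto simp: u_def)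
      then show ?thesis using P(3) by (metis comp_apply rangeE)
    qed
    then have "A (u m) = \<delta> m" for m by (intro A_eq) (simp_all add: \<delta> u_def)
    then show "t n (u m) = (if n = m then 1 else 0)" for n m by (simp add: t_def \<delta>_def)
  qed
qed

end

section \<open>Direct sums of a basic sequence and l1\<close>

lemma sums_even_odd:
  fixes a :: "nat \<Rightarrow> 'b::real_normed_vector"
  assumes "(\<lambda>n. a (2 * n)) sums p" "(\<lambda>n. a (2 * n + 1)) sums q"
  shows "a sums (p + q)"
proof -
  have ev: "(\<lambda>m. if even m then a m else 0) sums p"
    using assms(1) sums_mono_reindex[of "\<lambda>n. 2 * n" "\<lambda>m. if even m then a m else 0" p]
    by (force simp: strict_mono_def elim!: evenE)
  have od: "(\<lambda>m. if odd m then a m else 0) sums q"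
    using assms(2) sums_mono_reindex[of "\<lambda>n. 2 * n + 1" "\<lambda>m. if odd m then a m else 0" q]
    by (force simp: strict_mono_def elim!: oddE)
  have "(\<lambda>m. (if even m then a m else 0) + (if odd m then a m else 0)) = a" by auto
  then show ?thesis using sums_add[OF ev od] by simp
qed

text \<open>The space is the direct sum of a subspace with basis \<open>v\<close> and a copy of l1
  with unit vectors \<open>e k\<close> for \<open>k \<in> J\<close>;
  \<open>f - ell1_synthesis es e f\<close> is the component in the former. Padding by zero outside
  \<open>J\<close> keeps all natural numbers as index set after a subsequence has been
  removed.\<close>

locale basis_ell1_system = banach_space_over smul
  for smul :: "'k::{real_normed_field, euclidean_space} \<Rightarrow> 'a::banach \<Rightarrow> 'a" +
  fixes v :: "nat \<Rightarrow> 'a" and vs :: "nat \<Rightarrow> 'a \<Rightarrow> 'k"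
    and e :: "nat \<Rightarrow> 'a" and es :: "nat \<Rightarrow> 'a \<Rightarrow> 'k" and J :: "nat set" and K :: real
  assumes K_ge_1: "K \<ge> 1"
    and vs_functional: "bounded_functional smul (vs n)"
    and es_functionals: "ell1_functionals es K"
    and vs_v: "vs n (v m) = (if n = m then 1 else 0)"
    and vs_e: "vs n (e k) = 0"
    and es_v: "es k (v n) = 0"
    and es_e: "es k (e l) = (if k = l \<and> k \<in> J then 1 else 0)"
    and e_notin: "k \<notin> J \<Longrightarrow> e k = 0"
    and es_notin: "k \<notin> J \<Longrightarrow> es k f = 0"
    and norm_v: "norm (v n) \<le> K"
    and norm_e: "norm (e k) \<le> K"
    and norm_vs: "norm (vs n f) \<le> K * norm f"
    and norm_partial_sum: "norm (\<Sum>n<N. smul (vs n f) (v n)) \<le> K * norm f"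
    and expansion: "(\<lambda>n. smul (vs n f) (v n)) sums (f - ell1_synthesis es e f)"

context banach_space_over
begin

text \<open>
  Doubling the indices of the complemented copy of \<open>\<ell>\<^sub>1\<close> embeds the whole space
  onto a complement of the span of the odd-indexed vectors of that copy.
\<close>

lemma basis_ell1_system_exists:
  assumes x: "schauder_basis smul x" and "K0 > 0" and t: "ell1_functionals t K0"
    and u: "\<And>n. norm (u n) \<le> K0" and tu: "\<And>n m. t n (u m) = (if n = m then 1 else 0)"
  obtains v vs e es K where "basis_ell1_system smul v vs e es UNIV K"
proof -
  have t_fun: "bounded_functional smul (t n)" for n using t by (simp add: ell1_functionals_def)
  have t2: "ell1_functionals (\<lambda>n. t (2 * n)) K0" and t21: "ell1_functionals (\<lambda>n. t (2 * n + 1)) K0"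
    by (rule ell1_functionals_reindex[OF t], simp add: strict_mono_def)+
  \<comment> \<open>\<open>F1\<close> projects onto the span of the \<open>u n\<close>;
    \<open>F2\<close> and \<open>F3\<close> compose it with the doubling of indices and with the
    left inverse of doubling that kills odd indices; \<open>G\<close> projects onto the odd-indexed
    span. Thus \<open>V\<close> doubles indices in the copy of l1 and is the identity on its
    complement, and \<open>W\<close> undoes this.\<close>
  define F1 where "F1 = ell1_synthesis t u"
  define F2 where "F2 = ell1_synthesis t (\<lambda>n. u (2 * n))"
  define F3 where "F3 = ell1_synthesis (\<lambda>n. t (2 * n)) u"
  define G where "G = ell1_synthesis (\<lambda>n. t (2 * n + 1)) (\<lambda>n. u (2 * n + 1))"
  define V where "V f = f - F1 f + F2 f" for f
  define W where "W f = f - F1 f + F3 f" for f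
  note defs = F1_def F2_def F3_def
  have F_lin: "bounded_linear F1" "bounded_linear F2" "bounded_linear F3"
    unfolding defs
    using bounded_linear_ell1_synthesis[where b=u, OF t u] bounded_linear_ell1_synthesis[where b=u, OF t2 u]
      bounded_linear_ell1_synthesis[where b="\<lambda>n. u (2 * n)", OF t u] by blast+
  have lin: "bounded_linear V" "bounded_linear W"
    unfolding V_def W_def
    by (intro bounded_linear_add bounded_linear_sub bounded_linear_ident F_lin)+
  have scale: "V (smul c f) = smul c (V f)" "W (smul c f) = smul c (W f)" for c f
    unfolding V_def W_def defs
    by (simp_all add: ell1_synthesis_scale[where b=u, OF t u] ell1_synthesis_scale[where b="\<lambda>n. u (2 * n)", OF t u]
        ell1_synthesis_scale[where b=u, OF t2 u] scale_right_distrib scale_right_diff_distrib)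
  have tF1: "t m (F1 f) = t m f" for m f
    using functional_ell1_synthesis_single[where b=u, OF t u t_fun, of m m f] by (simp add: defs tu)
  have tF2: "t (2 * m) (F2 f) = t m f" for m f
    using functional_ell1_synthesis_single[where b="\<lambda>n. u (2 * n)", OF t u t_fun, of m "2 * m" f]
    by (simp add: defs tu)
  have tF2': "t (2 * m + 1) (F2 f) = 0" for m f
    using functional_ell1_synthesis_single[where b="\<lambda>n. u (2 * n)", OF t u t_fun, of m "2 * m + 1" f]
    by (simp add: defs tu)
  have tF3: "t m (F3 f) = t (2 * m) f" for m f
    using functional_ell1_synthesis_single[where b=u, OF t2 u t_fun, of m m f] by (simp add: defs tu)
  note t_lin = linear_simps[OF conjunct1[OF t_fun[unfolded bounded_functional_def]]]
  have tV: "t (2 * m) (V f) = t m f" "t (2 * m + 1) (V f) = 0" for m f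
    unfolding V_def by (simp_all only: t_lin tF1 tF2 tF2') simp_all
  have tW: "t m (W f) = t (2 * m) f" for m f
    unfolding W_def by (simp only: t_lin tF1 tF3) simp
  have F1_split: "F1 f = ell1_synthesis (\<lambda>n. t (2 * n)) (\<lambda>n. u (2 * n)) f + G f" for f
  proof -
    have "(\<lambda>n. smul (t n f) (u n)) sums
        (ell1_synthesis (\<lambda>n. t (2 * n)) (\<lambda>n. u (2 * n)) f + G f)"
      unfolding G_def
      by (rule sums_even_odd)
         (rule ell1_synthesis_sums[where b="\<lambda>n. u (2 * n)", OF t2 u]
           ell1_synthesis_sums[where b="\<lambda>n. u (2 * n + 1)", OF t21 u])+
    then show ?thesis using ell1_synthesis_sums[where b=u, OF t u, of f] by (simp add: defs sums_unique2)
  qed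
  have F1V: "F1 (V f) = F2 f" for f
    unfolding F1_split unfolding G_def ell1_synthesis_def F2_def tV by simp
  have F3V: "F3 (V f) = F1 f" for f
    unfolding F1_def F3_def ell1_synthesis_def tV ..
  \<comment> \<open>With \<open>VW\<close> below, this shows that \<open>V\<close> maps the whole
    space isomorphically onto the kernel of \<open>G\<close>.\<close>
  have WV: "W (V f) = f" for f
    unfolding W_def F1V F3V by (simp add: V_def)
  have F1W: "F1 (W f) = F3 f" for f
    unfolding F1_def F3_def ell1_synthesis_def tW ..
  have F2W: "F2 (W f) = ell1_synthesis (\<lambda>n. t (2 * n)) (\<lambda>n. u (2 * n)) f" for f
    unfolding F2_def ell1_synthesis_def tW ..
  have VW: "V (W f) = f - G f" for f
    unfolding V_def[of "W f"] F1W F2W using F1_split[of f] by (simp add: W_def)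
  have F1u: "F1 (u k) = u k" for k
  proof -
    have "(\<lambda>n. smul (t n (u k)) (u n)) = (\<lambda>n. if n = k then u n else 0)" by (auto simp: tu)
    then show ?thesis using ell1_synthesis_sums[where b=u, OF t u, of "u k"] sums_single[of k u]
      by (simp add: defs sums_unique2)
  qed
  have "t (2 * n) (u (2 * k + 1)) = 0" for n k unfolding tu by (rule if_not_P) presburger
  then have "F3 (u (2 * k + 1)) = 0" for k
    unfolding F3_def ell1_synthesis_def by simp
  then have Wu: "W (u (2 * k + 1)) = 0" for k unfolding W_def F1u by simp
  obtain Kx where Kx: "Kx > 0"
    "\<And>N f. norm (\<Sum>n<N. smul (coord smul x n f) (x n)) \<le> Kx * norm f"
    using basis_partial_sums_bounded[OF x] by blast
  obtain KV where KV: "KV > 0" "\<And>f. norm (V f) \<le> KV * norm f"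
    using bounded_linear.pos_bounded[OF lin(1)] by (auto simp: mult.commute)
  obtain KW where KW: "KW > 0" "\<And>f. norm (W f) \<le> KW * norm f"
    using bounded_linear.pos_bounded[OF lin(2)] by (auto simp: mult.commute)
  have x0: "norm (x n) > 0" for n using schauder_basis_nonzero[OF x] by simp
  have coord_le: "norm (coord smul x n f) * norm (x n) \<le> 2 * Kx * norm f" for n f
  proof -
    define s where "s N = (\<Sum>i<N. smul (coord smul x i f) (x i))" for N
    have "norm (coord smul x n f) * norm (x n) = norm (s (Suc n) - s n)"
      by (simp add: s_def norm_scale)
    also have "\<dots> \<le> norm (s (Suc n)) + norm (s n)" by (rule norm_triangle_ineq4)
    also have "\<dots> \<le> Kx * norm f + Kx * norm f"
      unfolding s_def by (intro add_mono Kx)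
    finally show ?thesis by simp
  qed
  \<comment> \<open>The norms of the given basis need not be bounded above or away from zero, so
    they are divided out.\<close>
  define v where "v n = smul (of_real (1 / norm (x n))) (V (x n))" for n
  define vs where "vs n f = of_real (norm (x n)) * coord smul x n (W f)" for n f
  have vs_v_smul: "smul (vs n f) (v n) = V (smul (coord smul x n (W f)) (x n))" for n f
    using x0[of n] by (simp add: vs_def v_def scale mult.commute)
  have sum_v: "(\<Sum>n<N. smul (vs n f) (v n)) = V (\<Sum>n<N. smul (coord smul x n (W f)) (x n))" for N f
    unfolding vs_v_smul by (simp add: linear_sum[OF bounded_linear.linear[OF lin(1)]])
  have coord_fun: "bounded_functional smul (coord smul x n)" for n
  proof (rule bounded_functional_of_bound)
    show "norm (coord smul x n f) \<le> (2 * Kx / norm (x n)) * norm f" for f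
      using coord_le[of n f] x0[of n] by (simp add: field_simps)
  qed (simp_all add: coord_add[OF x] coord_scale[OF x])
  have prod_pos: "Kx * KV * KW > 0" "Kx * KW > 0" using Kx KV KW by simp_all
  define K where "K = 1 + K0 + 2 * Kx * KW + KV + KV * Kx * KW"
  have K: "1 \<le> K" "K0 \<le> K" "2 * Kx * KW \<le> K" "KV \<le> K" "KV * Kx * KW \<le> K"
    using \<open>K0 > 0\<close> prod_pos KV(1) by (simp_all add: K_def mult_ac)
  have "basis_ell1_system smul v vs (\<lambda>n. u (2 * n + 1)) (\<lambda>n. t (2 * n + 1)) UNIV K"
  proof
    show "K \<ge> 1" by fact
    show "bounded_functional smul (vs n)" for n
      unfolding vs_def by (intro bounded_functional_cmult bounded_functional_comp[OF coord_fun lin(2)] scale)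
    show "ell1_functionals (\<lambda>n. t (2 * n + 1)) K"
      using t21 K(2) unfolding ell1_functionals_def
      by (meson mult_right_mono norm_ge_zero order_trans)
    show "vs n (v m) = (if n = m then 1 else 0)" for n m
      using x0[of m] by (simp add: vs_def v_def scale WV coord_scale[OF x] coord_basis[OF x])
    show "vs n (u (2 * k + 1)) = 0" for n k
      unfolding vs_def Wu using coord_diff[OF x, of n 0 0] by simp
    show "t (2 * k + 1) (v n) = 0" for k n
      using t_fun[of "2 * k + 1"] by (simp only: v_def bounded_functional_def tV) simp
    show "t (2 * k + 1) (u (2 * l + 1)) = (if k = l \<and> k \<in> UNIV then 1 else 0)" for k l
      by (simp add: tu)
    show "norm (v n) \<le> K" for n
    proof -
      have "norm (v n) = norm (V (x n)) / norm (x n)" using x0[of n] by (simp add: v_def norm_scale norm_divide)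
      also have "\<dots> \<le> KV" using KV(2)[of "x n"] x0[of n] by (simp add: field_simps)
      finally show ?thesis using K by simp
    qed
    show "norm (u (2 * k + 1)) \<le> K" for k using u K order_trans by blast
    show "norm (vs n f) \<le> K * norm f" for n f
    proof -
      have "norm (vs n f) \<le> 2 * Kx * norm (W f)"
        using coord_le[of n "W f"] by (simp add: vs_def norm_mult mult.commute)
      also have "\<dots> \<le> 2 * Kx * (KW * norm f)" using Kx KW by (intro mult_left_mono) auto
      also have "\<dots> \<le> K * norm f" using K(3) by (simp add: mult_right_mono flip: mult.assoc)
      finally show ?thesis .
    qed
    show "norm (\<Sum>n<N. smul (vs n f) (v n)) \<le> K * norm f" for N f
    proof -
      have "norm (\<Sum>n<N. smul (vs n f) (v n)) \<le>
          KV * norm (\<Sum>n<N. smul (coord smul x n (W f)) (x n))"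
        unfolding sum_v by (rule KV)
      also have "\<dots> \<le> KV * (Kx * norm (W f))"
        using KV Kx by (intro mult_left_mono) auto
      also have "\<dots> \<le> KV * (Kx * (KW * norm f))"
        using KV Kx KW by (intro mult_left_mono) auto
      also have "\<dots> \<le> K * norm f" using K(5) by (simp add: mult_right_mono flip: mult.assoc)
      finally show ?thesis .
    qed
    show "(\<lambda>n. smul (vs n f) (v n)) sums
        (f - ell1_synthesis (\<lambda>n. t (2 * n + 1)) (\<lambda>n. u (2 * n + 1)) f)" for f
      using bounded_linear.sums[OF lin(1) coord_sums[OF x, of "W f"]]
      unfolding VW vs_v_smul G_def .
  qed auto
  then show thesis by (rule that)
qed

end

section \<open>Splitting off a difference basis\<close>

context banach_space_over
begin

lemma ell1_functionals_sum_le: "(\<Sum>n\<in>F. norm (t n f)) \<le> K * norm f"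
  if "ell1_functionals t K" "finite F"
proof -
  have "summable (\<lambda>n. norm (t n f))" "(\<Sum>n. norm (t n f)) \<le> K * norm f"
    using that by (simp_all add: ell1_functionals_def)
  then show ?thesis using sum_le_suminf[of "\<lambda>n. norm (t n f)" F] that(2) by simp
qed

lemma ell1_functionals_mono:
  assumes t: "ell1_functionals t K" and "\<And>n. bounded_functional smul (s n)"
    and st: "\<And>n f. norm (s n f) \<le> norm (t n f)" and "K \<le> L"
  shows "ell1_functionals s L"
proof -
  have "summable (\<lambda>n. norm (s n f)) \<and> (\<Sum>n. norm (s n f)) \<le> L * norm f" for f
  proof -
    have sm: "summable (\<lambda>n. norm (t n f))" and le: "(\<Sum>n. norm (t n f)) \<le> K * norm f"
      using t by (simp_all add: ell1_functionals_def)
    have sms: "summable (\<lambda>n. norm (s n f))"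
      by (rule summable_comparison_test'[OF sm, of 0]) (simp add: st)
    have "(\<Sum>n. norm (s n f)) \<le> (\<Sum>n. norm (t n f))" by (rule suminf_le[OF st sms sm])
    also note le
    also have "K * norm f \<le> L * norm f" using \<open>K \<le> L\<close> by (rule mult_right_mono) simp
    finally show ?thesis using sms by blast
  qed
  then show ?thesis using assms(2) by (simp add: ell1_functionals_def)
qed

text \<open>Summation is bounded on l1 by absolute convergence; applied to tails it yields the
  coordinate functionals of the difference basis.\<close>

lemma ell1_functionals_suminf:
  assumes "ell1_functionals t K"
  shows "bounded_functional smul (\<lambda>f. \<Sum>n. t n f)" and "norm (\<Sum>n. t n f) \<le> K * norm f"
proof -
  have sm: "summable (\<lambda>n. norm (t n f))" and le: "(\<Sum>n. norm (t n f)) \<le> K * norm f"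
    and fn: "bounded_functional smul (t n)" for n f
    using assms by (simp_all add: ell1_functionals_def)
  note sm' = summable_norm_cancel[OF sm]
  have bd: "norm (\<Sum>n. t n f) \<le> K * norm f" for f
    using summable_norm[OF sm[of f]] le[of f] by simp
  then show "norm (\<Sum>n. t n f) \<le> K * norm f" .
  show "bounded_functional smul (\<lambda>f. \<Sum>n. t n f)"
  proof (rule bounded_functional_of_bound[OF _ _ bd])
    show "(\<Sum>n. t n (f + g)) = (\<Sum>n. t n f) + (\<Sum>n. t n g)" for f g
      using fn by (simp add: bounded_functional_def linear_simps suminf_add[OF sm' sm'])
    show "(\<Sum>n. t n (smul c f)) = c * (\<Sum>n. t n f)" for c f
      using fn by (simp add: bounded_functional_def suminf_mult[OF sm'])
  qed
qed

text \<open>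
  The subsequence of the \<open>\<ell>\<^sub>1\<close>-basis indexed by the range of \<open>st\<close> is replaced by
  its differences, whose conditionality constants grow linearly, and interleaved with the given
  basic sequence.
\<close>

lemma difference_system_exists:
  fixes st :: "nat \<Rightarrow> nat"
  assumes sys: "basis_ell1_system smul v vs e es UNIV K" and st: "strict_mono st"
  obtains z zs w ws L where "basis_ell1_system smul z zs w ws (- range st) L"
    "\<And>M. norm (\<Sum>m<M. z (2 * m)) \<le> L"
    "\<And>M. real M \<le> L * norm (\<Sum>m<M. z (4 * m))"
proof -
  interpret basis_ell1_system smul v vs e es UNIV K by fact
  have st_eq: "st i = st j \<longleftrightarrow> i = j" for i j using st by (simp add: strict_mono_eq)
  define h where "h m = e (st m)" for m
  define hs where "hs m = es (st m)" for m
  \<comment> \<open>In an expansion in the differences \<open>d m\<close>, the vector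
    \<open>h m\<close> receives the coefficient of \<open>d m\<close> minus that of
    \<open>d (m + 1)\<close>. The tail sums \<open>R m\<close> have just these differences
    \<open>hs m\<close>, so they are the coordinates for \<open>d\<close>.\<close>
  define R where "R m f = (\<Sum>i. hs (i + m) f)" for m f
  define d where "d m = h m - (if m = 0 then 0 else h (m - 1))" for m
  define z where "z n = (if even n then d (n div 2) else v (n div 2))" for n
  define zs where "zs n = (if even n then R (n div 2) else vs (n div 2))" for n
  define w where "w k = (if k \<in> range st then 0 else e k)" for k
  define ws where "ws k = (if k \<in> range st then \<lambda>f. 0 else es k)" for k
  \<comment> \<open>\<open>2 * K * K\<close> is for partial sums of the difference basis, the
    remaining \<open>K * K\<close> for those of \<open>v\<close>.\<close>
  define L where "L = 3 * K * K"
  have KK: "K \<le> K * K" using K_ge_1 by simp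
  then have L: "L \<ge> 1" "K \<le> L" "2 * K \<le> L" "K * K \<le> L"
    using K_ge_1 by (simp_all only: L_def)
  have e_lin: "es k (f - g) = es k f - es k g" "vs k (f - g) = vs k f - vs k g"
    "es k 0 = 0" "vs k 0 = 0" for k f g
    using es_functionals vs_functional by (simp_all add: ell1_functionals_def bounded_functional_def linear_simps)
  have hs: "ell1_functionals hs K"
    unfolding hs_def by (rule ell1_functionals_reindex[OF es_functionals st])
  have hs_shift: "ell1_functionals (\<lambda>i. hs (i + m)) K" for m
    by (rule ell1_functionals_reindex[OF hs]) (simp add: strict_mono_def)
  have hs_sum: "summable (\<lambda>i. hs i f)" for f
    by (rule summable_norm_cancel) (use hs in \<open>simp add: ell1_functionals_def\<close>)
  have R_fun: "bounded_functional smul (R m)" and R_norm: "norm (R m f) \<le> K * norm f" for m f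
    unfolding R_def using ell1_functionals_suminf[OF hs_shift] by simp_all
  have R_eq: "R m f = (\<Sum>i. hs i f) - (\<Sum>i<m. hs i f)" for m f
    using suminf_minus_initial_segment[OF hs_sum] by (simp add: R_def)
  have R_Suc: "R m f = hs m f + R (Suc m) f" for m f by (simp add: R_eq)
  have R_lim: "(\<lambda>m. R m f) \<longlonglongrightarrow> 0" for f
    unfolding R_eq using tendsto_diff[OF tendsto_const summable_LIMSEQ[OF hs_sum[of f]], of "\<Sum>i. hs i f"]
    by simp
  have hs_h: "hs i (h m) = (if i = m then 1 else 0)" for i m
    by (simp add: hs_def h_def es_e st_eq)
  have R_h: "R n (h m) = (if n \<le> m then 1 else 0)" for n m
    unfolding R_eq hs_h using sums_single[of m "\<lambda>_. 1 :: 'k"]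
    by (simp add: sums_iff if_distrib cong: if_cong)
  have R_lin: "R n (f - g) = R n f - R n g" "R n 0 = 0" for n f g
    using R_fun by (simp_all add: bounded_functional_def linear_simps)
  have R_d: "R n (d m) = (if n = m then 1 else 0)" for n m
    by (auto simp: d_def R_lin R_h)
  have R_0: "R n f = 0" if "\<And>i. es (st i) f = 0" for n f
    using that by (simp add: R_def hs_def)
  have h_norm: "norm (h m) \<le> K" for m using norm_e by (simp add: h_def)
  have d_norm: "norm (d m) \<le> 2 * K" for m
  proof -
    have "norm (d m) \<le> norm (h m) + norm (if m = 0 then 0 else h (m - 1))"
      unfolding d_def by (rule norm_triangle_ineq4)
    also have "\<dots> \<le> K + K" using h_norm[of m] h_norm[of "m - 1"] K_ge_1 by (intro add_mono) auto
    finally show ?thesis by simp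
  qed
  \<comment> \<open>Summation by parts. The boundary term carries the tail \<open>R M f\<close>,
    which is bounded and tends to 0.\<close>
  have sum_d: "(\<Sum>m<M. smul (R m f) (d m)) =
      (\<Sum>m<M. smul (hs m f) (h m)) + (if M = 0 then 0 else smul (R M f) (h (M - 1)))" for M f
  proof (induction M)
    case (Suc M)
    have "smul (R M f) (h M) = smul (hs M f) (h M) + smul (R (Suc M) f) (h M)"
      using R_Suc[of M f] by (simp add: scale_left_distrib)
    then show ?case using Suc by (simp add: d_def scale_right_diff_distrib)
  qed simp
  have sum_d_norm: "norm (\<Sum>m<M. smul (R m f) (d m)) \<le> 2 * K * K * norm f" for M f
  proof -
    have "norm (\<Sum>m<M. smul (hs m f) (h m)) \<le> K * (\<Sum>m<M. norm (hs m f))"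
      by (rule norm_sum_smul_le) (rule h_norm)
    also have "\<dots> \<le> K * (K * norm f)"
      using K_ge_1 by (intro mult_left_mono ell1_functionals_sum_le[OF hs]) auto
    finally have 1: "norm (\<Sum>m<M. smul (hs m f) (h m)) \<le> K * K * norm f" by simp
    have "norm (smul (R M f) (h (M - 1))) \<le> (K * norm f) * K"
      unfolding norm_scale using K_ge_1 by (intro mult_mono R_norm h_norm) auto
    then have 2: "norm (if M = 0 then 0 else smul (R M f) (h (M - 1))) \<le> K * K * norm f"
      using K_ge_1 by (simp add: mult_ac)
    show ?thesis unfolding sum_d using norm_triangle_mono[OF 1 2] by simp
  qed
  have d_sums: "(\<lambda>m. smul (R m f) (d m)) sums ell1_synthesis hs h f" for f
  proof -
    have "(\<lambda>M. if M = 0 then 0 else smul (R M f) (h (M - 1))) \<longlonglongrightarrow> 0"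
    proof (rule Lim_null_comparison)
      show "\<forall>\<^sub>F M in sequentially. norm (if M = 0 then 0 else smul (R M f) (h (M - 1))) \<le> norm (R M f) * K"
        using K_ge_1 by (intro always_eventually allI) (auto simp: norm_scale intro!: mult_left_mono h_norm)
      show "(\<lambda>M. norm (R M f) * K) \<longlonglongrightarrow> 0"
        by (intro tendsto_mult_left_zero tendsto_norm_zero R_lim)
    qed
    with ell1_synthesis_sums[where b=h, OF hs h_norm, of f]
    have "(\<lambda>M. (\<Sum>m<M. smul (hs m f) (h m)) + (if M = 0 then 0 else smul (R M f) (h (M - 1))))
        \<longlonglongrightarrow> ell1_synthesis hs h f + 0"
      unfolding sums_def by (rule tendsto_add)
    then show ?thesis unfolding sums_def sum_d by simp
  qed
  have synth_split: "ell1_synthesis es e f = ell1_synthesis hs h f + ell1_synthesis ws w f" for f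
  proof -
    define a where "a k = (if k \<in> range st then smul (es k f) (e k) else 0)" for k
    have "(\<lambda>m. a (st m)) sums ell1_synthesis hs h f"
      using ell1_synthesis_sums[where b=h, OF hs h_norm, of f] by (simp add: a_def hs_def h_def)
    then have a: "a sums ell1_synthesis hs h f"
      by (subst (asm) sums_mono_reindex[OF st]) (auto simp: a_def)
    have "(\<lambda>k. smul (es k f) (e k) - a k) sums (ell1_synthesis es e f - ell1_synthesis hs h f)"
      by (intro sums_diff a ell1_synthesis_sums[where b=e, OF es_functionals norm_e])
    moreover have "(\<lambda>k. smul (es k f) (e k) - a k) = (\<lambda>k. smul (ws k f) (w k))"
      by (auto simp: a_def ws_def w_def)
    ultimately show ?thesis by (simp add: ell1_synthesis_def sums_iff algebra_simps)
  qed
  have partial: "(\<Sum>n<N. smul (zs n f) (z n)) =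
      (\<Sum>m<(N + 1) div 2. smul (R m f) (d m)) + (\<Sum>m<N div 2. smul (vs m f) (v m))" for N f
  proof (induction N)
    case (Suc N)
    show ?case
    proof (cases "even N")
      case True
      then have "Suc (Suc N) div 2 = Suc (N div 2)" "Suc N div 2 = N div 2" by auto
      then show ?thesis using Suc True by (simp add: zs_def z_def)
    next
      case False
      then have "Suc (Suc N) div 2 = Suc N div 2" "Suc N div 2 = Suc (N div 2)" by (auto elim!: oddE)
      then show ?thesis using Suc False by (simp add: zs_def z_def)
    qed
  qed simp
  have z_even: "z (2 * m) = d m" for m by (simp add: z_def)
  have "basis_ell1_system smul z zs w ws (- range st) L"
  proof
    show "L \<ge> 1" by (rule L)
    show "bounded_functional smul (zs n)" for n by (simp add: zs_def R_fun vs_functional)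
    show "ell1_functionals ws L"
    proof (rule ell1_functionals_mono[OF es_functionals _ _ L(2)])
      show "bounded_functional smul (ws n)" for n
        using es_functionals by (simp add: ws_def bounded_functional_zero ell1_functionals_def)
    qed (simp add: ws_def)
    show "zs n (z m) = (if n = m then 1 else 0)" for n m
    proof -
      have 1: "vs k (d l) = 0" for k l by (simp add: d_def h_def e_lin vs_e)
      have 2: "R k (v l) = 0" for k l by (rule R_0) (rule es_v)
      have "n = m \<longleftrightarrow> even n = even m \<and> n div 2 = m div 2" by presburger
      then show ?thesis by (auto simp: zs_def z_def R_d vs_v 1 2)
    qed
    show "zs n (w k) = 0" for n k
    proof (cases "k \<in> range st")
      case True
      then show ?thesis by (simp add: zs_def w_def R_lin e_lin)
    next
      case False
      then have "R m (e k) = 0" for m by (intro R_0) (auto simp: es_e)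
      with False show ?thesis by (simp add: zs_def w_def vs_e)
    qed
    show "ws k (z n) = 0" for k n
      by (auto simp: ws_def z_def d_def h_def e_lin es_v es_e)
    show "ws k (w l) = (if k = l \<and> k \<in> - range st then 1 else 0)" for k l
      by (auto simp: ws_def w_def es_e e_lin)
    show "norm (z n) \<le> L" for n
      using d_norm[of "n div 2"] norm_v[of "n div 2"] L by (simp add: z_def)
    show "norm (w k) \<le> L" for k using norm_e[of k] L by (simp add: w_def)
    show "norm (zs n f) \<le> L * norm f" for n f
    proof -
      have "norm (zs n f) \<le> K * norm f" by (simp add: zs_def R_norm norm_vs)
      also have "\<dots> \<le> L * norm f" using L(2) by (rule mult_right_mono) simp
      finally show ?thesis .
    qed
    show "norm (\<Sum>n<N. smul (zs n f) (z n)) \<le> L * norm f" for N f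
    proof -
      have "norm (\<Sum>n<N. smul (zs n f) (z n)) \<le> 2 * K * K * norm f + K * norm f"
        unfolding partial by (rule norm_triangle_mono[OF sum_d_norm norm_partial_sum])
      also have "\<dots> = (2 * K * K + K) * norm f" by (simp add: distrib_right)
      also have "\<dots> \<le> L * norm f" using KK by (intro mult_right_mono) (simp_all add: L_def)
      finally show ?thesis .
    qed
    show "(\<lambda>n. smul (zs n f) (z n)) sums (f - ell1_synthesis ws w f)" for f
    proof -
      have "(\<lambda>n. smul (zs n f) (z n)) sums (ell1_synthesis hs h f + (f - ell1_synthesis es e f))"
        by (rule sums_even_odd) (simp_all add: zs_def z_def d_sums expansion)
      then show ?thesis by (simp add: synth_split)
    qed
  qed (auto simp: w_def ws_def)
  moreover have "norm (\<Sum>m<M. z (2 * m)) \<le> L" for M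
  proof -
    \<comment> \<open>Consecutive differences telescope to a single unit vector.\<close>
    have "(\<Sum>m<M. d m) = (if M = 0 then 0 else h (M - 1))"
      by (induction M) (auto simp: d_def)
    then show ?thesis using h_norm[of "M - 1"] L unfolding z_even by simp
  qed
  moreover have "real M \<le> L * norm (\<Sum>m<M. z (4 * m))" for M
  proof -
    \<comment> \<open>Every second difference leaves nothing to cancel: the \<open>h (2 * m)\<close>
      all survive with coefficient 1, and counting the even places alone already gives
      \<open>M\<close>.\<close>
    define g where "g = (\<Sum>m<M. d (2 * m))"
    have g: "(\<Sum>m<M. z (4 * m)) = g" using z_even[of "2 * _"] by (simp add: g_def)
    have "hs (2 * i) (d (2 * m)) = (if m = i then 1 else 0)" for i m
    proof -
      have "hs (2 * i) (d (2 * m)) = hs (2 * i) (h (2 * m)) - (if m = 0 then 0 else hs (2 * i) (h (2 * m - 1)))"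
        by (simp add: d_def hs_def e_lin)
      also have "(if m = 0 then 0 else hs (2 * i) (h (2 * m - 1))) = 0"
      proof -
        have "m = 0 \<or> 2 * i \<noteq> 2 * m - 1" by presburger
        then show ?thesis unfolding hs_h by (metis (full_types))
      qed
      finally show ?thesis by (simp add: hs_h eq_commute)
    qed
    moreover have "bounded_linear (hs (2 * i))" for i
      using hs by (simp add: ell1_functionals_def bounded_functional_def)
    ultimately have "hs (2 * i) g = (if i < M then 1 else 0)" for i
      unfolding g_def by (simp add: linear_sum[OF bounded_linear.linear])
    then have "real M = (\<Sum>i<M. norm (hs (2 * i) g))" by simp
    also have "\<dots> \<le> K * norm g"
      using ell1_functionals_sum_le[OF ell1_functionals_reindex[OF hs, of "\<lambda>i. 2 * i"], of "{..<M}" g]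
      by (simp add: strict_mono_def)
    also have "\<dots> \<le> L * norm g" using L(2) by (rule mult_right_mono) simp
    finally show ?thesis unfolding g .
  qed
  ultimately show thesis by (rule that)
qed

end

section \<open>The block construction\<close>

text \<open>The shift by one puts index 0 alone into block 0 and gives block \<open>n\<close>
  exactly \<open>2 ^ n\<close> indices.\<close>

definition blk :: "nat \<Rightarrow> nat" where
  "blk k = floor_log (k + 1)"

definition block_start :: "nat \<Rightarrow> nat" where
  "block_start n = 2 ^ n - 1"

definition block :: "nat \<Rightarrow> nat set" where
  "block n = {block_start n..<block_start (Suc n)}"

lemma two_power_blk_le: "2 ^ blk k \<le> k + 1"
  unfolding blk_def by (rule floor_log_exp2_le) simp

lemma less_two_power_blk: "k + 1 < 2 ^ Suc (blk k)"
  unfolding blk_def using floor_log_exp2_gt[of "k + 1"] by simp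

lemma mem_block_iff: "k \<in> block n \<longleftrightarrow> blk k = n"
proof
  assume "k \<in> block n"
  then have k: "2 ^ n \<le> k + 1" "k + 1 < 2 ^ Suc n" by (auto simp: block_def block_start_def)
  have "(2::nat) ^ n < 2 ^ Suc (blk k)" "(2::nat) ^ blk k < 2 ^ Suc n"
    using two_power_blk_le[of k] less_two_power_blk[of k] k by linarith+
  then have "n < Suc (blk k)" "blk k < Suc n"
    using power_less_imp_less_exp[of "2::nat"] by (meson one_less_numeral_iff semiring_norm(76))+
  then show "blk k = n" by simp
next
  assume "blk k = n"
  then show "k \<in> block n"
    using two_power_blk_le[of k] less_two_power_blk[of k] by (auto simp: block_def block_start_def)
qed

lemma finite_block [simp]: "finite (block n)"
  by (simp add: block_def)

lemma card_block: "card (block n) = 2 ^ n"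
  by (simp add: block_def block_start_def)

lemma strict_mono_block_start: "strict_mono block_start"
proof (rule strict_monoI)
  fix m n :: nat assume "m < n"
  then have "(2::nat) ^ m < 2 ^ n" "1 \<le> (2::nat) ^ m" by simp_all
  then show "block_start m < block_start n" unfolding block_start_def by linarith
qed

lemma sum_blocks: "sum g {..<block_start N} = (\<Sum>n<N. sum g (block n))"
  for g :: "nat \<Rightarrow> 'b::comm_monoid_add"
proof (induction N)
  case (Suc N)
  have "sum g {0..<block_start (Suc N)} = sum g {0..<block_start N} + sum g (block N)"
    unfolding block_def
    by (rule sum.atLeastLessThan_concat[symmetric])
       (simp_all add: strict_mono_less_eq[OF strict_mono_block_start])
  then show ?case using Suc by (simp add: atLeast0LessThan)
qed (simp add: block_start_def)

lemma block_start_mem: "block_start n \<in> block n"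
  using strict_mono_block_start by (simp add: block_def strict_mono_def)

lemma blk_block_start [simp]: "blk (block_start n) = n"
  using block_start_mem by (simp add: mem_block_iff)

lemma mem_range_block_start: "k \<in> range block_start \<longleftrightarrow> k = block_start (blk k)"
  by (metis blk_block_start rangeE rangeI)

lemma filterlim_blk: "filterlim blk at_top at_top"
proof (rule filterlim_at_top_mono)
  show "filterlim (\<lambda>k. floor_log (k + 1)) at_top at_top"
    unfolding filterlim_at_top
  proof
    fix Z
    have "Z \<le> floor_log (k + 1)" if "2 ^ Z \<le> k" for k
      using floor_log_le_iff[of "2 ^ Z" "k + 1"] that by simp
    then show "\<forall>\<^sub>F k in at_top. Z \<le> floor_log (k + 1)"
      unfolding eventually_at_top_linorder by blast
  qed
qed (simp add: blk_def)

section \<open>The new basis and its coordinate functionals\<close>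

locale blocked_system = basis_ell1_system smul v vs e es "- range block_start" K
  for smul :: "'k::{real_normed_field, euclidean_space} \<Rightarrow> 'a::banach \<Rightarrow> 'a"
    and v vs e es K
begin

text \<open>
  The vectors of one block, expanded with coefficients \<open>a\<close>, have component \<open>\<Sum> a\<close> along
  \<open>v n\<close>, and their \<open>\<ell>\<^sub>1\<close>-component is the deviation of \<open>a\<close> from its mean. A sequence of
  sum zero is determined by its entries off the start of the block, with equivalence of norms, which
  is why \<open>e\<close> vanishes there.
\<close>

definition y :: "nat \<Rightarrow> 'a" where
  "y k = v (blk k) + e k - smul (1 / 2 ^ blk k) (\<Sum>i\<in>block (blk k). e i)"

text \<open>The deviation of the coefficients from their block mean: \<open>es\<close> gives it away
  from the start of the block, and the entry at the start is the one that makes the block sum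
  zero.\<close>

definition q :: "nat \<Rightarrow> 'a \<Rightarrow> 'k" where
  "q k f = es k f - (if k = block_start (blk k) then \<Sum>i\<in>block (blk k). es i f else 0)"

text \<open>Mean plus deviation. The component along \<open>v n\<close> is the sum of the
  coefficients in block \<open>n\<close>, so the mean is \<open>vs n f / 2 ^ n\<close>.\<close>

definition a :: "nat \<Rightarrow> 'a \<Rightarrow> 'k" where
  "a k f = vs (blk k) f / 2 ^ blk k + q k f"

lemma es_functional: "bounded_functional smul (es k)"
  using es_functionals by (simp add: ell1_functionals_def)

lemma q_functional: "bounded_functional smul (q k)"
proof (cases "k = block_start (blk k)")
  case True
  then have "q k = (\<lambda>f. es k f - (\<Sum>i\<in>block (blk k). es i f))" by (auto simp: q_def)
  then show ?thesis by (simp add: bounded_functional_diff bounded_functional_sum es_functional)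
next
  case False
  then have "q k = es k" by (auto simp: q_def)
  then show ?thesis by (simp add: es_functional)
qed

lemma a_functional: "bounded_functional smul (a k)"
proof -
  have "a k = (\<lambda>f. (1 / 2 ^ blk k) * vs (blk k) f + q k f)" by (auto simp: a_def)
  then show ?thesis
    by (simp only: bounded_functional_add bounded_functional_cmult vs_functional q_functional)
qed

lemma e_start: "e (block_start n) = 0" and es_start: "es (block_start n) f = 0"
  using e_notin es_notin by blast+

lemma sum_q_block: "(\<Sum>k\<in>block n. q k f) = 0"
proof -
  have "(\<Sum>k\<in>block n. q k f) =
      (\<Sum>k\<in>block n. es k f - (if k = block_start n then \<Sum>i\<in>block n. es i f else 0))"
    by (rule sum.cong) (simp_all add: q_def mem_block_iff)
  also have "\<dots> = 0"
    using block_start_mem[of n] by (simp add: sum_subtractf sum.delta)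
  finally show ?thesis .
qed

lemma sum_a_block: "(\<Sum>k\<in>block n. a k f) = vs n f"
proof -
  have "(\<Sum>k\<in>block n. a k f) = (\<Sum>k\<in>block n. vs n f / 2 ^ n + q k f)"
    by (rule sum.cong) (simp_all add: a_def mem_block_iff)
  then show ?thesis by (simp add: sum.distrib sum_q_block card_block)
qed

text \<open>The balancing entry at the start is at most the sum of the others, whence the factor
  2.\<close>

lemma sum_norm_q_block: "(\<Sum>k\<in>block n. norm (q k f)) \<le> 2 * (\<Sum>k\<in>block n. norm (es k f))"
proof -
  define s where "s = (\<Sum>k\<in>block n. norm (es k f))"
  have "(\<Sum>k\<in>block n. norm (q k f)) \<le>
      (\<Sum>k\<in>block n. norm (es k f) + (if k = block_start n then s else 0))"
  proof (rule sum_mono)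
    fix k assume "k \<in> block n"
    then have "blk k = n" by (simp add: mem_block_iff)
    then have "norm (q k f) \<le> norm (es k f) + norm (if k = block_start n then \<Sum>i\<in>block n. es i f else 0)"
      unfolding q_def using norm_triangle_ineq4 by blast
    also have "norm (if k = block_start n then \<Sum>i\<in>block n. es i f else 0) \<le>
        (if k = block_start n then s else 0)"
      unfolding s_def by (simp add: norm_sum)
    finally show "norm (q k f) \<le> norm (es k f) + (if k = block_start n then s else 0)" by simp
  qed
  also have "\<dots> = 2 * s"
    using block_start_mem[of n] by (simp add: sum.distrib s_def)
  finally show ?thesis by (simp add: s_def)
qed

lemma sum_norm_q:
  assumes "finite F"
  shows "(\<Sum>k\<in>F. norm (q k f)) \<le> 2 * K * norm f"
proof -
  obtain N where N: "F \<subseteq> {..<N}" using assms finite_nat_bounded by blast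
  \<comment> \<open>The bound on \<open>q\<close> holds block by block only, so \<open>F\<close> is
    enlarged to a union of whole blocks.\<close>
  have "N \<le> block_start N" unfolding block_start_def using less_exp[of N] by linarith
  then have "(\<Sum>k\<in>F. norm (q k f)) \<le> (\<Sum>k<block_start N. norm (q k f))"
    using N by (intro sum_mono2) auto
  also have "\<dots> \<le> (\<Sum>n<N. 2 * (\<Sum>k\<in>block n. norm (es k f)))"
    unfolding sum_blocks by (intro sum_mono sum_norm_q_block)
  also have "\<dots> = 2 * (\<Sum>k<block_start N. norm (es k f))"
    by (simp add: sum_blocks sum_distrib_left)
  also have "\<dots> \<le> 2 * (K * norm f)"
    by (intro mult_left_mono ell1_functionals_sum_le[OF es_functionals]) auto
  finally show ?thesis by simp
qed

text \<open>The mean part is spread evenly over \<open>2 ^ n\<close> indices and so contributes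
  \<open>norm (vs n f)\<close> in total.\<close>

lemma sum_norm_a_block: "(\<Sum>k\<in>block n. norm (a k f)) \<le> norm (vs n f) + (\<Sum>k\<in>block n. norm (q k f))"
proof -
  have "(\<Sum>k\<in>block n. norm (a k f)) \<le> (\<Sum>k\<in>block n. norm (vs n f) / 2 ^ n + norm (q k f))"
  proof (rule sum_mono)
    fix k assume "k \<in> block n"
    then have "blk k = n" by (simp add: mem_block_iff)
    then show "norm (a k f) \<le> norm (vs n f) / 2 ^ n + norm (q k f)"
      unfolding a_def using norm_triangle_ineq[of "vs n f / 2 ^ n" "q k f"]
      by (simp add: norm_divide norm_power)
  qed
  then show ?thesis by (simp add: sum.distrib card_block)
qed

lemma norm_y: "norm (y k) \<le> 3 * K"
proof -
  let ?n = "blk k"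
  have "norm (\<Sum>i\<in>block ?n. e i) \<le> 2 ^ ?n * K"
    using sum_norm_bound[of "block ?n" e K] norm_e by (simp add: card_block)
  then have "norm (smul (1 / 2 ^ ?n) (\<Sum>i\<in>block ?n. e i)) \<le> K"
    by (simp add: norm_scale norm_divide norm_power field_simps)
  then show ?thesis
    using norm_triangle_ineq4[of "v ?n + e k" "smul (1 / 2 ^ ?n) (\<Sum>i\<in>block ?n. e i)"]
      norm_triangle_ineq[of "v ?n" "e k"] norm_v[of ?n] norm_e[of k] by (simp add: y_def)
qed

text \<open>Over a whole block the mean parts of the coefficients produce a multiple of the sum of
  the \<open>e i\<close>, which the mean subtracted in \<open>y\<close> cancels. Whole blocks thus
  reproduce the expansions in \<open>v\<close> and \<open>e\<close>.\<close>

lemma sum_block_y: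
  "(\<Sum>k\<in>block n. smul (a k f) (y k)) = smul (vs n f) (v n) + (\<Sum>k\<in>block n. smul (es k f) (e k))"
proof -
  define W where "W = (\<Sum>i\<in>block n. e i)"
  have "(\<Sum>k\<in>block n. smul (a k f) (y k)) =
      (\<Sum>k\<in>block n. smul (a k f) (v n) + smul (vs n f / 2 ^ n) (e k) + smul (es k f) (e k)
        - smul (a k f) (smul (1 / 2 ^ n) W))"
  proof (rule sum.cong)
    fix k assume "k \<in> block n"
    then have k: "blk k = n" by (simp add: mem_block_iff)
    \<comment> \<open>\<open>q\<close> and \<open>es\<close> differ only at the start of the block,
      where \<open>e\<close> vanishes.\<close>
    have "smul (q k f) (e k) = smul (es k f) (e k)"
      using e_start[of n] k by (auto simp: q_def)
    then have "smul (a k f) (e k) = smul (vs n f / 2 ^ n) (e k) + smul (es k f) (e k)"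
      using k by (simp add: a_def scale_left_distrib)
    then show "smul (a k f) (y k) =
        smul (a k f) (v n) + smul (vs n f / 2 ^ n) (e k) + smul (es k f) (e k)
          - smul (a k f) (smul (1 / 2 ^ n) W)"
      using k by (simp add: y_def W_def scale_right_distrib scale_right_diff_distrib)
  qed simp
  also have "\<dots> = smul (\<Sum>k\<in>block n. a k f) (v n) + smul (vs n f / 2 ^ n) W
      + (\<Sum>k\<in>block n. smul (es k f) (e k)) - smul (\<Sum>k\<in>block n. a k f) (smul (1 / 2 ^ n) W)"
    by (simp only: sum.distrib sum_subtractf scale_sum_left[symmetric] scale_sum_right[symmetric] W_def)
  finally show ?thesis by (simp add: sum_a_block)
qed

lemma biorthogonal: "a k (y l) = (if k = l then 1 else 0)"
proof -
  let ?n = "blk l" and ?R = "range block_start"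
  have lin: "\<phi> (y l) = \<phi> (v ?n) + \<phi> (e l) - (1 / 2 ^ ?n) * (\<Sum>i\<in>block ?n. \<phi> (e i))"
    if "bounded_functional smul \<phi>" for \<phi>
  proof -
    have bl: "bounded_linear \<phi>" and sc: "\<And>c f. \<phi> (smul c f) = c * \<phi> f"
      using that by (simp_all add: bounded_functional_def)
    show ?thesis unfolding y_def
      by (simp only: linear_simps[OF bl] sc linear_sum[OF bounded_linear.linear[OF bl]])
  qed
  have vs_y: "vs n (y l) = (if n = ?n then 1 else 0)" for n
    using lin[OF vs_functional[of n]] by (simp add: vs_v vs_e)
  have es_y: "es i (y l) = (if i = l \<and> i \<notin> ?R then 1 else 0) -
      (if blk i = ?n \<and> i \<notin> ?R then 1 / 2 ^ ?n else 0)" for i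
  proof -
    have "(\<Sum>j\<in>block ?n. es i (e j)) = (\<Sum>j\<in>block ?n. if j = i then (if i \<notin> ?R then 1 else 0) else 0)"
      by (rule sum.cong) (auto simp: es_e)
    also have "\<dots> = (if blk i = ?n \<and> i \<notin> ?R then 1 else 0)"
      by (auto simp: mem_block_iff)
    finally show ?thesis using lin[OF es_functional[of i]] by (auto simp: es_v es_e)
  qed
  show ?thesis
  proof (cases "blk k = ?n")
    case False
    have "(\<Sum>i\<in>block (blk k). es i (y l)) = 0"
      by (rule sum.neutral) (use False in \<open>auto simp: es_y mem_block_iff\<close>)
    then show ?thesis using False by (auto simp: a_def q_def vs_y es_y)
  next
    case True
    show ?thesis
    proof (cases "k \<in> ?R")
      case False
      then have "k \<noteq> block_start (blk k)" by (metis mem_range_block_start)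
      then show ?thesis using True False by (simp add: a_def q_def vs_y es_y)
    next
      case k: True
      then have k_eq: "k = block_start ?n" using True by (metis mem_range_block_start)
      have in_R: "i \<in> ?R \<longleftrightarrow> i = k" if "i \<in> block ?n" for i
        using that k_eq by (metis mem_range_block_start mem_block_iff)
      \<comment> \<open>The term for \<open>i = k\<close> restores the mean at the start of the
        block, where \<open>es\<close> vanishes instead of taking the value minus the mean.\<close>
      have "(\<Sum>i\<in>block ?n. es i (y l)) =
          (\<Sum>i\<in>block ?n. (if i = l then (if l \<noteq> k then 1 else 0) else 0) - 1 / 2 ^ ?n +
            (if i = k then 1 / 2 ^ ?n else 0))"
        by (rule sum.cong) (auto simp: es_y in_R mem_block_iff simp del: image_iff)
      also have "\<dots> = (if l \<noteq> k then 1 else 0) - 1 + 1 / 2 ^ ?n"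
        using True by (simp add: sum.distrib sum_subtractf mem_block_iff card_block)
      finally have s: "(\<Sum>i\<in>block ?n. es i (y l)) = (if l \<noteq> k then 1 else 0) - 1 + 1 / 2 ^ ?n" .
      have "es k (y l) = 0" unfolding k_eq by (rule es_start)
      then show ?thesis using True s k_eq by (auto simp: a_def q_def vs_y)
    qed
  qed
qed

section \<open>Partial sums and convergence of the expansions\<close>

lemma norm_sum_y: "norm (\<Sum>k\<in>F. smul (a k f) (y k)) \<le> 3 * K * (\<Sum>k\<in>F. norm (a k f))"
  by (rule norm_sum_smul_le) (rule norm_y)

lemma sum_whole_blocks:
  "(\<Sum>k<block_start N. smul (a k f) (y k)) =
    (\<Sum>n<N. smul (vs n f) (v n)) + (\<Sum>k<block_start N. smul (es k f) (e k))"
  by (simp add: sum_blocks sum_block_y sum.distrib)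

text \<open>A sum over whole initial blocks is a partial sum along \<open>v\<close>, bounded by the
  basis constant, plus a partial sum in l1.\<close>

lemma norm_sum_whole_blocks: "norm (\<Sum>k<block_start N. smul (a k f) (y k)) \<le> 2 * K * K * norm f"
proof -
  have "norm (\<Sum>k<block_start N. smul (es k f) (e k)) \<le> K * (\<Sum>k<block_start N. norm (es k f))"
    by (rule norm_sum_smul_le) (rule norm_e)
  also have "\<dots> \<le> K * (K * norm f)"
    using K_ge_1 by (intro mult_left_mono ell1_functionals_sum_le[OF es_functionals]) auto
  finally have 1: "norm (\<Sum>k<block_start N. smul (es k f) (e k)) \<le> K * K * norm f" by simp
  have "K * norm f \<le> K * K * norm f" using K_ge_1 by (intro mult_right_mono) auto
  then have 2: "norm (\<Sum>n<N. smul (vs n f) (v n)) \<le> K * K * norm f"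
    using norm_partial_sum[of f N] by simp
  show ?thesis unfolding sum_whole_blocks using norm_triangle_mono[OF 2 1] by simp
qed

text \<open>Partial sums ending at a block boundary converge by \<open>expansion\<close>. A further
  incomplete block costs at most \<open>3 * K * B n\<close>, where \<open>B n\<close> bounds the sum
  of the coefficients of the block and tends to 0.\<close>

lemma sums_y: "(\<lambda>k. smul (a k f) (y k)) sums f"
proof -
  define B where "B n = norm (vs n f) + 2 * (\<Sum>k\<in>block n. norm (es k f))" for n
  have pow: "filterlim block_start at_top at_top"
    by (rule filterlim_subseq[OF strict_mono_block_start])
  have vs_0: "(\<lambda>n. norm (vs n f)) \<longlonglongrightarrow> 0"
  proof (rule Lim_null_comparison)
    show "\<forall>\<^sub>F n in sequentially. norm (norm (vs n f)) \<le> K * norm (smul (vs n f) (v n))"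
    proof (intro always_eventually allI)
      fix n
      \<comment> \<open>Testing \<open>norm_vs\<close> on a single term of the expansion bounds
        \<open>vs n f\<close> by that term, and the terms tend to 0.\<close>
      have "vs n (smul (vs n f) (v n)) = vs n f"
        using vs_functional[of n] by (simp add: bounded_functional_def vs_v)
      then show "norm (norm (vs n f)) \<le> K * norm (smul (vs n f) (v n))"
        using norm_vs[of n "smul (vs n f) (v n)"] by simp
    qed
    show "(\<lambda>n. K * norm (smul (vs n f) (v n))) \<longlonglongrightarrow> 0"
      by (intro tendsto_mult_right_zero tendsto_norm_zero summable_LIMSEQ_zero
          sums_summable[OF expansion])
  qed
  have es_0: "(\<lambda>n. \<Sum>k\<in>block n. norm (es k f)) \<longlonglongrightarrow> 0"
  proof -
    define s where "s N = (\<Sum>k<N. norm (es k f))" for N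
    have "summable (\<lambda>k. norm (es k f))" using es_functionals by (simp add: ell1_functionals_def)
    then have s: "s \<longlonglongrightarrow> (\<Sum>k. norm (es k f))"
      unfolding s_def by (rule summable_LIMSEQ)
    have "(\<lambda>n. s (block_start (Suc n)) - s (block_start n)) \<longlonglongrightarrow>
        (\<Sum>k. norm (es k f)) - (\<Sum>k. norm (es k f))"
      using filterlim_compose[OF s pow] by (intro tendsto_diff LIMSEQ_Suc)
    moreover have "s (block_start (Suc n)) - s (block_start n) = (\<Sum>k\<in>block n. norm (es k f))" for n
      unfolding s_def sum_blocks by simp
    ultimately show ?thesis by simp
  qed
  have B_0: "B \<longlonglongrightarrow> 0"
    unfolding B_def using tendsto_add[OF vs_0 tendsto_mult_right_zero[OF es_0, of 2]] by simp
  define T where "T N = (\<Sum>k<block_start N. smul (a k f) (y k))" for N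
  have T_lim: "T \<longlonglongrightarrow> f"
  proof -
    have "(\<lambda>N. \<Sum>k<block_start N. smul (es k f) (e k)) \<longlonglongrightarrow> ell1_synthesis es e f"
      using filterlim_compose[OF _ pow] ell1_synthesis_sums[where b=e, OF es_functionals norm_e, of f]
      unfolding sums_def by blast
    from tendsto_add[OF expansion[of f, unfolded sums_def] this] show ?thesis
      unfolding T_def sum_whole_blocks by simp
  qed
  have near: "norm ((\<Sum>k<m. smul (a k f) (y k)) - T (blk m)) \<le> 3 * K * B (blk m)" for m
  proof -
    let ?n = "blk m"
    have le: "block_start ?n \<le> m" unfolding block_start_def using two_power_blk_le[of m] by linarith
    have "(\<Sum>k<m. smul (a k f) (y k)) - T ?n = (\<Sum>k\<in>{block_start ?n..<m}. smul (a k f) (y k))"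
      using sum.atLeastLessThan_concat[OF _ le, of 0 "\<lambda>k. smul (a k f) (y k)"]
      by (simp add: T_def atLeast0LessThan algebra_simps)
    then have "norm ((\<Sum>k<m. smul (a k f) (y k)) - T ?n) \<le>
        3 * K * (\<Sum>k\<in>{block_start ?n..<m}. norm (a k f))"
      using norm_sum_y by simp
    also have "\<dots> \<le> 3 * K * (\<Sum>k\<in>block ?n. norm (a k f))"
      using K_ge_1 less_two_power_blk[of m]
      by (intro mult_left_mono sum_mono2) (auto simp: block_def block_start_def)
    also have "\<dots> \<le> 3 * K * B ?n"
      using K_ge_1 sum_norm_a_block[where n="?n" and f=f] sum_norm_q_block[where n="?n" and f=f] unfolding B_def
      by (intro mult_left_mono) auto
    finally show ?thesis .
  qed
  have "(\<lambda>m. (\<Sum>k<m. smul (a k f) (y k)) - T (blk m)) \<longlonglongrightarrow> 0"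
  proof (rule Lim_null_comparison)
    show "(\<lambda>m. 3 * K * B (blk m)) \<longlonglongrightarrow> 0"
      by (intro tendsto_mult_right_zero filterlim_compose[OF B_0 filterlim_blk])
  qed (use near in auto)
  from tendsto_add[OF this filterlim_compose[OF T_lim filterlim_blk]]
  show ?thesis by (simp add: sums_def)
qed

lemma schauder_basis_y: "schauder_basis smul y" and coord_y: "coord smul y k f = a k f"
  using schauder_basisI[OF a_functional biorthogonal sums_y] by auto

end

section \<open>Greedy approximation and conditionality\<close>

context blocked_system
begin

text \<open>
  On blocks where the mean of the coefficients is at most \<open>t / 2\<close> the \<open>\<ell>\<^sub>1\<close>-component controls
  the count; the remaining blocks have size less than \<open>2 * K * norm f / t\<close>, and block sizes grow
  geometrically.
\<close>

lemma large_coefficients: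
  assumes "finite A" "t \<ge> 0" and A: "\<And>k. k \<in> A \<Longrightarrow> t \<le> norm (a k f)"
  shows "t * real (card A) \<le> 8 * K * norm f"
proof (cases "t = 0")
  case True
  then show ?thesis using K_ge_1 by simp
next
  case False
  with \<open>t \<ge> 0\<close> have t: "t > 0" by simp
  define A1 where "A1 = {k \<in> A. norm (vs (blk k) f) / 2 ^ blk k \<le> t / 2}"
  define A2 where "A2 = {k \<in> A. norm (vs (blk k) f) / 2 ^ blk k > t / 2}"
  have fin: "finite A1" "finite A2" using \<open>finite A\<close> by (auto simp: A1_def A2_def)
  have "real (card A1) * (t / 2) \<le> (\<Sum>k\<in>A1. norm (q k f))"
  proof (rule sum_bounded_below)
    fix k assume "k \<in> A1"
    then have "t \<le> norm (a k f)" "norm (vs (blk k) f) / 2 ^ blk k \<le> t / 2"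
      using A by (auto simp: A1_def)
    moreover have "norm (a k f) \<le> norm (vs (blk k) f) / 2 ^ blk k + norm (q k f)"
      unfolding a_def using norm_triangle_ineq[of "vs (blk k) f / 2 ^ blk k" "q k f"]
      by (simp add: norm_divide norm_power)
    ultimately show "t / 2 \<le> norm (q k f)" by linarith
  qed
  also have "\<dots> \<le> 2 * K * norm f" by (rule sum_norm_q[OF fin(1)])
  finally have 1: "t * real (card A1) \<le> 4 * K * norm f" by (simp add: mult_ac)
  \<comment> \<open>As \<open>k + 1 < 2 * 2 ^ blk k\<close>, a bound on the block size bounds the
    index itself, and hence the number of such indices.\<close>
  have "A2 \<subseteq> {..<nat \<lfloor>4 * K * norm f / t\<rfloor>}"
  proof
    fix k assume "k \<in> A2"
    then have "t / 2 * 2 ^ blk k < norm (vs (blk k) f)"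
      by (simp add: A2_def field_simps)
    then have "t / 2 * 2 ^ blk k < K * norm f" using norm_vs[of "blk k" f] by linarith
    moreover have "real (k + 1) < 2 * 2 ^ blk k"
      using less_two_power_blk[of k] by (metis of_nat_less_iff of_nat_power of_nat_numeral power_Suc)
    then have "t / 4 * real (k + 1) < t / 4 * (2 * 2 ^ blk k)"
      using t by (intro mult_strict_left_mono) auto
    ultimately have "t * real (k + 1) < 4 * K * norm f" by simp
    then have "real (k + 1) \<le> 4 * K * norm f / t" using t by (simp add: field_simps)
    then show "k \<in> {..<nat \<lfloor>4 * K * norm f / t\<rfloor>}" by (simp add: le_nat_floor less_eq_Suc_le)
  qed
  then have "card A2 \<le> nat \<lfloor>4 * K * norm f / t\<rfloor>"
    using card_mono[of "{..<nat \<lfloor>4 * K * norm f / t\<rfloor>}" A2] by simp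
  then have "real (card A2) \<le> 4 * K * norm f / t"
    using t K_ge_1 by (simp add: le_nat_iff le_floor_iff)
  then have 2: "t * real (card A2) \<le> 4 * K * norm f" using t by (simp add: field_simps)
  have "A = A1 \<union> A2" "A1 \<inter> A2 = {}" by (auto simp: A1_def A2_def)
  then have "card A = card A1 + card A2" using card_Un_disjoint[OF fin] by simp
  then show ?thesis using 1 2 by (simp add: distrib_left)
qed

text \<open>
  With \<open>t\<close> the least coefficient on \<open>A\<close>, blocks of size below \<open>2 * K * norm f / t\<close> are handled
  by projecting onto them completely and removing the small coefficients; on the other blocks
  the coefficients in \<open>A\<close> are dominated by the \<open>\<ell>\<^sub>1\<close>-component.
\<close>

lemma quasi_greedy:
  assumes "finite A" and greedy: "\<And>j k. j \<notin> A \<Longrightarrow> k \<in> A \<Longrightarrow> norm (a j f) \<le> norm (a k f)"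
  shows "norm (\<Sum>k\<in>A. smul (a k f) (y k)) \<le> 26 * K * K * norm f"
proof (cases "A = {}")
  case True
  then show ?thesis using K_ge_1 by simp
next
  case False
  define t where "t = Min ((\<lambda>k. norm (a k f)) ` A)"
  have t_le: "t \<le> norm (a k f)" if "k \<in> A" for k
    unfolding t_def using that \<open>finite A\<close> by simp
  have t_in: "t \<in> (\<lambda>k. norm (a k f)) ` A"
    unfolding t_def using False \<open>finite A\<close> by (intro Min_in) auto
  then have t_ge: "norm (a j f) \<le> t" if "j \<notin> A" for j using greedy that by auto
  have "t \<ge> 0" using t_in by auto
  show ?thesis
  proof (cases "t = 0")
    case True
    \<comment> \<open>All coefficients off \<open>A\<close> vanish, so the projection is
      \<open>f\<close> itself.\<close>
    then have "smul (a k f) (y k) = 0" if "k \<notin> A" for k using t_ge[OF that] by simp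
    then have "(\<lambda>k. smul (a k f) (y k)) sums (\<Sum>k\<in>A. smul (a k f) (y k))"
      by (intro sums_finite[OF \<open>finite A\<close>])
    then have "(\<Sum>k\<in>A. smul (a k f) (y k)) = f" by (rule sums_unique2[OF _ sums_y])
    moreover have "1 * norm f \<le> 26 * K * K * norm f"
      using K_ge_1 mult_mono[of 1 K 1 K] by (intro mult_right_mono) auto
    ultimately show ?thesis by simp
  next
    case False
    with \<open>t \<ge> 0\<close> have t: "t > 0" by simp
    \<comment> \<open>Blocks of size at least \<open>L\<close> have mean at most
      \<open>t / 2\<close>, because \<open>norm (vs n f) \<le> K * norm f\<close>. \<open>N\<close>
      is the first such block, and its minimality leaves at most \<open>2 * L\<close> indices before
      it.\<close>
    define L where "L = 2 * K * norm f / t"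
    have "L \<ge> 0" using t K_ge_1 by (simp add: L_def)
    have tL: "t * L = 2 * K * norm f" using t by (simp add: L_def)
    define N where "N = (LEAST N. L \<le> 2 ^ N)"
    have "\<exists>N. L \<le> 2 ^ N" using real_arch_pow[of 2 L] by (auto intro: less_imp_le)
    then have N: "L \<le> 2 ^ N" unfolding N_def by (rule LeastI_ex)
    have start_le: "real (block_start N) \<le> 2 * L"
    proof (cases N)
      case 0
      then show ?thesis using \<open>L \<ge> 0\<close> by (simp add: block_start_def)
    next
      case (Suc M)
      then have "\<not> L \<le> 2 ^ M" unfolding N_def using not_less_Least by (metis lessI)
      then have "2 ^ N \<le> 2 * L" using Suc by simp
      moreover have "real (block_start N) \<le> 2 ^ N" by (simp add: block_start_def)
      ultimately show ?thesis by linarith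
    qed
    let ?I = "{..<block_start N}"
    have split: "(\<Sum>k\<in>A. smul (a k f) (y k)) = (\<Sum>k\<in>?I. smul (a k f) (y k))
        - (\<Sum>k\<in>?I - A. smul (a k f) (y k)) + (\<Sum>k\<in>A - ?I. smul (a k f) (y k))"
      using sum.Int_Diff[OF \<open>finite A\<close>, of "\<lambda>k. smul (a k f) (y k)" ?I]
        sum.Int_Diff[of ?I "\<lambda>k. smul (a k f) (y k)" A] by (simp add: Int_commute)
    have "norm (\<Sum>k\<in>?I - A. smul (a k f) (y k)) \<le> 3 * K * (\<Sum>k\<in>?I - A. norm (a k f))"
      by (rule norm_sum_y)
    also have "\<dots> \<le> 3 * K * (\<Sum>k\<in>?I - A. t)"
      using K_ge_1 t_ge by (intro mult_left_mono sum_mono) auto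
    also have "\<dots> \<le> 3 * K * (2 * L * t)"
    proof (rule mult_left_mono)
      have "real (card (?I - A)) \<le> real (card ?I)" by (intro of_nat_mono card_mono) auto
      then have "real (card (?I - A)) \<le> 2 * L" using start_le by simp
      then show "(\<Sum>k\<in>?I - A. t) \<le> 2 * L * t" using t by (simp add: mult_right_mono)
    qed (use K_ge_1 in simp)
    also have "\<dots> = 12 * K * K * norm f" using tL by (simp add: mult_ac)
    finally have small: "norm (\<Sum>k\<in>?I - A. smul (a k f) (y k)) \<le> 12 * K * K * norm f" .
    have q_ge: "norm (a k f) \<le> 2 * norm (q k f)" if "k \<in> A - ?I" for k
    proof -
      have "block_start N \<le> k" using that by simp
      moreover have "k < block_start (Suc (blk k))"
        using less_two_power_blk[of k] unfolding block_start_def by linarith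
      ultimately have "block_start N < block_start (Suc (blk k))" by simp
      then have "N \<le> blk k" by (simp add: strict_mono_less[OF strict_mono_block_start])
      then have "(2::real) ^ N \<le> 2 ^ blk k" by (rule power_increasing) simp
      with N have "L \<le> 2 ^ blk k" by (rule order_trans)
      then have "t * L \<le> t * 2 ^ blk k" using t by simp
      then have "norm (vs (blk k) f) / 2 ^ blk k \<le> t / 2"
        using norm_vs[of "blk k" f] unfolding tL by (simp add: field_simps)
      moreover have "norm (a k f) \<le> norm (vs (blk k) f) / 2 ^ blk k + norm (q k f)"
        unfolding a_def using norm_triangle_ineq[of "vs (blk k) f / 2 ^ blk k" "q k f"]
        by (simp add: norm_divide norm_power)
      moreover have "t \<le> norm (a k f)" using t_le that by simp
      ultimately show ?thesis by linarith
    qed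
    have "norm (\<Sum>k\<in>A - ?I. smul (a k f) (y k)) \<le> 3 * K * (\<Sum>k\<in>A - ?I. norm (a k f))"
      by (rule norm_sum_y)
    also have "\<dots> \<le> 3 * K * (\<Sum>k\<in>A - ?I. 2 * norm (q k f))"
      using K_ge_1 q_ge by (intro mult_left_mono sum_mono) auto
    also have "\<dots> \<le> 3 * K * (2 * (2 * K * norm f))"
      unfolding sum_distrib_left[symmetric] using K_ge_1 \<open>finite A\<close>
      by (intro mult_left_mono sum_norm_q) auto
    also have "\<dots> = 12 * K * K * norm f" by simp
    finally have large: "norm (\<Sum>k\<in>A - ?I. smul (a k f) (y k)) \<le> 12 * K * K * norm f" .
    have "norm (\<Sum>k\<in>A. smul (a k f) (y k)) \<le>
        norm (\<Sum>k\<in>?I. smul (a k f) (y k)) + norm (\<Sum>k\<in>?I - A. smul (a k f) (y k))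
          + norm (\<Sum>k\<in>A - ?I. smul (a k f) (y k))"
      unfolding split by (meson add_right_mono norm_triangle_ineq norm_triangle_ineq4 order_trans)
    \<comment> \<open>The constant 26 is 2 for the whole blocks plus 12 for each of the two
      corrections.\<close>
    then show ?thesis using norm_sum_whole_blocks[where N=N and f=f] small large by linarith
  qed
qed

section \<open>Almost greediness and the fundamental function\<close>

lemma a_projection:
  assumes "finite B"
  shows "a k (f - (\<Sum>l\<in>B. smul (a l f) (y l))) = (if k \<in> B then 0 else a k f)"
proof -
  have bl: "bounded_linear (a k)" and sc: "\<And>c f. a k (smul c f) = c * a k f"
    using a_functional[of k] by (simp_all add: bounded_functional_def)
  have "a k (f - (\<Sum>l\<in>B. smul (a l f) (y l))) = a k f - (\<Sum>l\<in>B. a l f * (if k = l then 1 else 0))"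
    by (simp only: linear_simps[OF bl] linear_sum[OF bounded_linear.linear[OF bl]] sc biorthogonal)
  then show ?thesis using assms by (simp add: if_distrib cong: if_cong)
qed

text \<open>With \<open>g = f - P B\<close>, the error \<open>f - P A\<close> is
  \<open>g + P (B - A) - P (A - B)\<close>. The set \<open>A - B\<close> is greedy for
  \<open>g\<close>, so \<open>quasi_greedy\<close> bounds its projection. \<open>B - A\<close> has
  no more elements than \<open>A - B\<close>, and no larger coefficients; with \<open>norm_y\<close>
  this reduces its projection to \<open>large_coefficients\<close> for \<open>g\<close>.\<close>

lemma almost_greedy_y: "almost_greedy smul y"
  unfolding almost_greedy_def
proof (intro exI[of _ "1 + 24 * K * K + 26 * K * K"] allI impI)
  fix f and A B :: "nat set"
  assume fin: "finite A" "finite B" and card: "card B \<le> card A"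
    and "\<forall>j\<in>- A. \<forall>k\<in>A. norm (coord smul y j f) \<le> norm (coord smul y k f)"
  then have greedy: "norm (a j f) \<le> norm (a k f)" if "j \<notin> A" "k \<in> A" for j k
    using that by (simp add: coord_y)
  define P where "P F = (\<Sum>k\<in>F. smul (a k f) (y k))" for F
  have proj: "coord_proj smul y F f = P F" if "finite F" for F
    using that by (simp add: coord_proj_finite coord_y P_def)
  define g where "g = f - P B"
  have a_g: "a k g = (if k \<in> B then 0 else a k f)" for k
    unfolding g_def P_def by (rule a_projection[OF fin(2)])
  have K0: "K \<ge> 0" "K * K \<ge> 0" using K_ge_1 by simp_all
  have "norm (P (A - B)) \<le> 26 * K * K * norm g"
  proof -
    have "P (A - B) = (\<Sum>k\<in>A - B. smul (a k g) (y k))"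
      unfolding P_def by (rule sum.cong) (simp_all add: a_g)
    also have "norm \<dots> \<le> 26 * K * K * norm g"
    proof (rule quasi_greedy)
      show "norm (a j g) \<le> norm (a k g)" if "j \<notin> A - B" "k \<in> A - B" for j k
        using that greedy by (auto simp: a_g)
    qed (use fin in simp)
    finally show ?thesis .
  qed
  moreover have "norm (P (B - A)) \<le> 24 * K * K * norm g"
  proof -
    have card': "card (B - A) \<le> card (A - B)"
      using card card_Diff_subset_Int[of B A] card_Diff_subset_Int[of A B] fin
      by (simp add: Int_commute card_mono)
    show ?thesis
    proof (cases "A - B = {}")
      case True
      then have "card (B - A) = 0" using card' by (simp only: card.empty le_zero_eq)
      then have "B - A = {}" using fin by (simp only: card_0_eq finite_Diff)
      then have "P (B - A) = 0" by (simp only: P_def sum.empty)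
      then show ?thesis using K0 by simp
    next
      case False
      define t where "t = Min ((\<lambda>k. norm (a k f)) ` (A - B))"
      have t_in: "t \<in> (\<lambda>k. norm (a k f)) ` (A - B)"
        unfolding t_def using False fin by (intro Min_in) auto
      have "t \<le> norm (a k g)" if "k \<in> A - B" for k
        using that fin by (simp add: a_g t_def)
      then have lc: "t * real (card (A - B)) \<le> 8 * K * norm g"
        using t_in fin by (intro large_coefficients) auto
      have "norm (P (B - A)) \<le> 3 * K * (\<Sum>k\<in>B - A. norm (a k f))"
        unfolding P_def by (rule norm_sum_y)
      also have "\<dots> \<le> 3 * K * (\<Sum>k\<in>B - A. t)"
        using K0 t_in greedy by (intro mult_left_mono sum_mono) auto
      also have "\<dots> \<le> 3 * K * (t * real (card (A - B)))"
        using K0 t_in card' by (intro mult_left_mono) (auto simp: mult.commute intro!: mult_right_mono)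
      also have "\<dots> \<le> 3 * K * (8 * K * norm g)" using lc K0 by (intro mult_left_mono) auto
      finally show ?thesis by simp
    qed
  qed
  moreover have "f - P A = g + P (B - A) - P (A - B)"
    unfolding g_def P_def
    using sum.Int_Diff[OF fin(1), of "\<lambda>k. smul (a k f) (y k)" B]
      sum.Int_Diff[OF fin(2), of "\<lambda>k. smul (a k f) (y k)" A] by (simp add: Int_commute)
  then have "norm (f - P A) \<le> norm g + norm (P (B - A)) + norm (P (A - B))"
    using norm_triangle_ineq4[of "g + P (B - A)" "P (A - B)"] norm_triangle_ineq[of g "P (B - A)"] by simp
  ultimately have "norm (f - P A) \<le> (1 + 24 * K * K + 26 * K * K) * norm g"
    by (simp add: distrib_right)
  then show "norm (f - coord_proj smul y A f) \<le>
      (1 + 24 * K * K + 26 * K * K) * norm (f - coord_proj smul y B f)"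
    using fin by (simp add: proj g_def)
qed

text \<open>The upper bound is the triangle inequality; the lower one is
  \<open>large_coefficients\<close> with threshold 1 for the sum of the first \<open>m\<close>
  vectors.\<close>

lemma fundamental_function_y: "equivalent_on {1..} (fundamental_function y) (\<lambda>m. of_nat m)"
  unfolding equivalent_on_def dominated_on_def
proof (intro conjI exI ballI)
  fix m :: nat
  have "norm (\<Sum>j\<in>A. y j) \<le> 3 * K * real m" if "finite A" "card A \<le> m" for A
  proof -
    have "norm (\<Sum>j\<in>A. y j) \<le> real (card A) * (3 * K)" by (rule sum_norm_bound) (rule norm_y)
    also have "\<dots> \<le> real m * (3 * K)" using that K_ge_1 by (intro mult_right_mono) auto
    finally show ?thesis by (simp add: mult_ac)
  qed
  moreover have "ennreal (3 * K) * of_nat m = ennreal (3 * K * real m)"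
    using K_ge_1 by (simp add: ennreal_of_nat_eq_real_of_nat ennreal_mult)
  ultimately show "fundamental_function y m \<le> ennreal (3 * K) * of_nat m"
    unfolding fundamental_function_def by (auto intro!: Sup_least ennreal_leI)
next
  fix m :: nat
  define g where "g = (\<Sum>j<m. y j)"
  have "a k g = 1" if "k < m" for k
  proof -
    have "linear (a k)" using a_functional[of k] by (simp add: bounded_functional_def bounded_linear.linear)
    then show ?thesis using that by (simp add: g_def linear_sum biorthogonal)
  qed
  then have "real m \<le> 8 * K * norm g"
    using large_coefficients[of "{..<m}" 1 g] by simp
  then have "of_nat m \<le> ennreal (8 * K) * ennreal (norm g)"
    using K_ge_1 by (simp add: ennreal_of_nat_eq_real_of_nat ennreal_leI flip: ennreal_mult)
  also have "ennreal (norm g) \<le> fundamental_function y m"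
    unfolding fundamental_function_def g_def by (intro Sup_upper CollectI exI[of _ "{..<m}"]) simp
  finally show "of_nat m \<le> ennreal (8 * K) * fundamental_function y m"
    by (simp add: mult_left_mono)
qed

section \<open>Logarithmic growth of the conditionality constants\<close>

lemma coord_proj_finite_supp:
  assumes "supp smul y f \<subseteq> {..<m}"
  shows "coord_proj smul y A f = (\<Sum>k\<in>A \<inter> {..<m}. smul (a k f) (y k))"
proof -
  have "coord_proj smul y A f = (\<Sum>k<m. if k \<in> A then smul (a k f) (y k) else 0)"
    unfolding coord_proj_def coord_y
    by (rule suminf_finite) (use assms in \<open>auto simp: supp_def coord_y\<close>)
  also have "\<dots> = (\<Sum>k\<in>A \<inter> {..<m}. smul (a k f) (y k))"
    by (subst Int_commute) (rule sum.inter_restrict[symmetric], simp)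
  finally show ?thesis .
qed

text \<open>The 5 is 2 + 3: \<open>2 ^ blk m \<le> m + 1 \<le> m ^ 2\<close> gives the 2, and the
  summand 3 is absorbed by \<open>ln 2 \<le> ln m\<close>.\<close>

lemma ln_two_power_blk:
  assumes "m \<ge> 2"
  shows "real (blk m) + 3 \<le> 5 / ln 2 * ln (real m)" "ln (real m) \<le> real (blk m) + 1"
proof -
  have "m + 1 \<le> m * 2" using assms by simp
  also have "\<dots> \<le> m * m" using assms by (intro mult_left_mono) auto
  finally have "2 ^ blk m \<le> m ^ 2" using two_power_blk_le[of m] by (simp add: power2_eq_square)
  then have "real (2 ^ blk m) \<le> real (m ^ 2)" by (rule of_nat_mono)
  then have "(2::real) ^ blk m \<le> real m ^ 2" by simp
  then have "ln ((2::real) ^ blk m) \<le> ln (real m ^ 2)" using assms by (subst ln_le_cancel_iff) auto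
  then have "real (blk m) * ln 2 \<le> 2 * ln (real m)" using assms by (simp add: ln_realpow)
  moreover have "ln 2 \<le> ln (real m)" using assms by simp
  ultimately have "(real (blk m) + 3) * ln 2 \<le> 5 * ln (real m)" by (simp add: distrib_right)
  then show "real (blk m) + 3 \<le> 5 / ln 2 * ln (real m)" by (simp add: field_simps)
  have "real m \<le> real (2 ^ Suc (blk m))" using less_two_power_blk[of m] by (intro of_nat_mono) linarith
  then have "ln (real m) \<le> ln ((2::real) ^ Suc (blk m))" using assms by (subst ln_le_cancel_iff) auto
  also have "\<dots> = real (Suc (blk m)) * ln 2" by (rule ln_realpow)
  also have "\<dots> \<le> real (Suc (blk m)) * 1" using ln_2_less_1 by (intro mult_left_mono) auto
  finally show "ln (real m) \<le> real (blk m) + 1" by simp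
qed

text \<open>By the triangle inequality the coefficients need only be summed. The indices below
  \<open>m\<close> meet at most \<open>blk m + 1\<close> blocks, each contributing at most
  \<open>K * norm f\<close> through its mean; the deviations add \<open>2 * K * norm f\<close> in
  all.\<close>

lemma conditionality_upper:
  assumes "supp smul y f \<subseteq> {..<m}"
  shows "norm (coord_proj smul y A f) \<le> 3 * K * K * (real (blk m) + 3) * norm f"
proof -
  define N where "N = Suc (blk m)"
  have m: "m \<le> block_start N"
    using less_two_power_blk[of m] unfolding N_def block_start_def by linarith
  have "norm (coord_proj smul y A f) \<le> 3 * K * (\<Sum>k\<in>A \<inter> {..<m}. norm (a k f))"
    unfolding coord_proj_finite_supp[OF assms] by (rule norm_sum_y)
  also have "\<dots> \<le> 3 * K * (\<Sum>k<block_start N. norm (a k f))"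
    using K_ge_1 m by (intro mult_left_mono sum_mono2) auto
  also have "(\<Sum>k<block_start N. norm (a k f)) \<le> (\<Sum>n<N. norm (vs n f) + (\<Sum>k\<in>block n. norm (q k f)))"
    unfolding sum_blocks by (intro sum_mono sum_norm_a_block)
  also have "\<dots> = (\<Sum>n<N. norm (vs n f)) + (\<Sum>k<block_start N. norm (q k f))"
    by (simp add: sum.distrib sum_blocks)
  also have "\<dots> \<le> real N * (K * norm f) + 2 * K * norm f"
    using sum_bounded_above[of "{..<N}" "\<lambda>n. norm (vs n f)" "K * norm f"] norm_vs
    by (intro add_mono sum_norm_q) auto
  also have "\<dots> = K * (real (blk m) + 3) * norm f" by (simp add: N_def algebra_simps)
  finally show ?thesis using K_ge_1 by (simp add: mult_ac)
qed

text \<open>The conditionality of \<open>v\<close> is transferred: projecting the sum of the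
  \<open>v (2 * n)\<close> onto every second of the blocks it meets leaves the sum of the
  \<open>v (4 * n)\<close>, since whole blocks act like single vectors of \<open>v\<close>. The
  first has norm at most \<open>D\<close>, the second at least \<open>M / D\<close>.\<close>

lemma conditionality_lower:
  assumes v2: "norm (\<Sum>n<2 * M. v (2 * n)) \<le> D" and v4: "real M \<le> D * norm (\<Sum>n<M. v (4 * n))"
    and M: "M > 0" "4 * M \<le> Suc (blk m)"
  shows "\<exists>A f. f \<noteq> 0 \<and> supp smul y f \<subseteq> {..<m} \<and>
    real M \<le> D * D * (norm (coord_proj smul y A f) / norm f)"
proof -
  define f where "f = (\<Sum>n<2 * M. v (2 * n))"
  define A where "A = (\<Union>n<M. block (4 * n))"
  have vs_f: "vs n f = (if even n \<and> n < 4 * M then 1 else 0)" for n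
  proof -
    have "linear (vs n)" using vs_functional[of n] by (simp add: bounded_functional_def bounded_linear.linear)
    then have "vs n f = (\<Sum>i<2 * M. if n = 2 * i then 1 else 0)"
      by (simp add: f_def linear_sum vs_v)
    also have "\<dots> = (if even n \<and> n < 4 * M then 1 else 0)"
    proof (cases "even n")
      case True
      then obtain j where j: "n = 2 * j" by (elim evenE)
      have "(\<Sum>i<2 * M. if n = 2 * i then 1 else 0) = (\<Sum>i<2 * M. if i = j then 1 else (0::'k))"
        unfolding j by (rule sum.cong) auto
      then show ?thesis using j by simp
    qed (auto intro!: sum.neutral)
    finally show ?thesis .
  qed
  have es_f: "es k f = 0" for k
  proof -
    have "linear (es k)" using es_functional[of k] by (simp add: bounded_functional_def bounded_linear.linear)
    then show ?thesis by (simp add: f_def linear_sum es_v)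
  qed
  have a_f: "a k f = vs (blk k) f / 2 ^ blk k" for k by (simp add: a_def q_def es_f)
  have "f \<noteq> 0" using vs_f[of 0] M vs_functional[of 0] by (auto simp: bounded_functional_def linear_simps)
  have supp: "supp smul y f \<subseteq> {..<m}"
  proof
    fix k assume "k \<in> supp smul y f"
    then have "vs (blk k) f \<noteq> 0" by (auto simp: supp_def coord_y a_f)
    \<comment> \<open>An even number below \<open>4 * M\<close> is at most \<open>4 * M - 2\<close>.
      This spare unit puts the block of \<open>k\<close> strictly before that of \<open>m\<close>,
      hence entirely below \<open>m\<close>.\<close>
    then have "Suc (Suc (blk k)) \<le> 4 * M" by (auto simp: vs_f split: if_splits elim!: evenE)
    then have "Suc (blk k) \<le> blk m" using M by linarith
    then have "(2::nat) ^ Suc (blk k) \<le> 2 ^ blk m" by (rule power_increasing) simp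
    then show "k \<in> {..<m}" using two_power_blk_le[of m] less_two_power_blk[of k] by simp
  qed
  have "A \<subseteq> {..<m}"
  proof
    fix k assume "k \<in> A"
    then obtain n where n: "n < M" "blk k = 4 * n" by (auto simp: A_def mem_block_iff)
    then have "a k f \<noteq> 0" by (simp add: a_f vs_f)
    then show "k \<in> {..<m}" using supp by (auto simp: supp_def coord_y)
  qed
  then have "coord_proj smul y A f = (\<Sum>k\<in>A. smul (a k f) (y k))"
    unfolding coord_proj_finite_supp[OF supp] by (simp add: Int_absorb2)
  also have "\<dots> = (\<Sum>n<M. \<Sum>k\<in>block (4 * n). smul (a k f) (y k))"
    unfolding A_def by (rule sum.UNION_disjoint) (auto simp: mem_block_iff)
  also have "\<dots> = (\<Sum>n<M. v (4 * n))"
    unfolding sum_block_y by (simp add: vs_f es_f)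
  finally have proj: "coord_proj smul y A f = (\<Sum>n<M. v (4 * n))" .
  have f: "0 < norm f" "norm f \<le> D" using \<open>f \<noteq> 0\<close> v2 by (simp_all add: f_def)
  then have "real M * norm f \<le> (D * norm (\<Sum>n<M. v (4 * n))) * D"
    using v4 by (intro mult_mono) auto
  then have "real M \<le> D * D * (norm (coord_proj smul y A f) / norm f)"
    unfolding proj using f by (simp add: field_simps)
  then show ?thesis using \<open>f \<noteq> 0\<close> supp by blast
qed

lemma conditionality_const_y:
  assumes "\<And>M. norm (\<Sum>n<M. v (2 * n)) \<le> D" "\<And>M. real M \<le> D * norm (\<Sum>n<M. v (4 * n))"
  shows "equivalent_on {2..} (conditionality_const smul y) (\<lambda>m. ennreal (ln (real m)))"
  unfolding equivalent_on_def dominated_on_def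
proof (intro conjI exI ballI)
  fix m :: nat assume "m \<in> {2..}"
  then have m: "m \<ge> 2" by simp
  define C where "C = 3 * K * K * (5 / ln 2)"
  have "norm (coord_proj smul y A f) / norm f \<le> C * ln (real m)"
    if "f \<noteq> 0" "supp smul y f \<subseteq> {..<m}" for A f
  proof -
    have "norm (coord_proj smul y A f) / norm f \<le> 3 * K * K * (real (blk m) + 3)"
      using conditionality_upper[OF that(2)] that(1) by (simp add: divide_le_eq)
    also have "\<dots> \<le> 3 * K * K * (5 / ln 2 * ln (real m))"
      using K_ge_1 ln_two_power_blk(1)[OF m] by (intro mult_left_mono) auto
    finally show ?thesis by (simp add: C_def)
  qed
  moreover have "ennreal C * ennreal (ln (real m)) = ennreal (C * ln (real m))"
    using m K_ge_1 by (simp add: C_def flip: ennreal_mult)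
  ultimately show "conditionality_const smul y m \<le> ennreal (3 * K * K * (5 / ln 2)) * ennreal (ln (real m))"
    unfolding C_def[symmetric] conditionality_const_def by (auto intro!: Sup_least ennreal_leI)
next
  fix m :: nat assume "m \<in> {2..}"
  then have m: "m \<ge> 2" by simp
  \<comment> \<open>The largest number allowed in \<open>conditionality_lower\<close>. It may be 0
    for small \<open>m\<close>; this case and the remainder 3 of the division are absorbed by the
    fact that the constant is at least 1.\<close>
  define M where "M = Suc (blk m) div 4"
  have blk_m: "real (blk m) + 1 \<le> 4 * real M + 3" unfolding M_def by linarith
  have up: "ennreal (norm (coord_proj smul y A f) / norm f) \<le> conditionality_const smul y m"
    if "f \<noteq> 0" "supp smul y f \<subseteq> {..<m}" for A f
    unfolding conditionality_const_def using that by (intro Sup_upper) blast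
  have supp_y0: "supp smul y (y 0) \<subseteq> {..<m}"
    using m by (auto simp: supp_def coord_y biorthogonal)
  have y0: "y 0 \<noteq> 0" by (rule schauder_basis_nonzero[OF schauder_basis_y])
  have "coord_proj smul y UNIV (y 0) = y 0"
    using coord_sums[OF schauder_basis_y, of "y 0"] by (simp add: coord_proj_def sums_iff)
  then have one: "1 \<le> conditionality_const smul y m"
    using up[OF y0 supp_y0, of UNIV] y0 by simp
  have M_le: "ennreal (real M) \<le> ennreal (D * D) * conditionality_const smul y m"
  proof (cases "M = 0")
    case False
    then obtain A f where Af: "f \<noteq> 0" "supp smul y f \<subseteq> {..<m}"
      "real M \<le> D * D * (norm (coord_proj smul y A f) / norm f)"
      using conditionality_lower[OF assms(1) assms(2), of M m] by (auto simp: M_def)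
    then have "ennreal (real M) \<le> ennreal (D * D) * ennreal (norm (coord_proj smul y A f) / norm f)"
      by (simp add: ennreal_leI flip: ennreal_mult)
    also have "\<dots> \<le> ennreal (D * D) * conditionality_const smul y m"
      by (intro mult_left_mono up Af) auto
    finally show ?thesis .
  qed simp
  have "ennreal (ln (real m)) \<le> ennreal (4 * real M + 3)"
    using ln_two_power_blk(2)[OF m] blk_m by (intro ennreal_leI) linarith
  also have "\<dots> = 4 * ennreal (real M) + 3 * 1"
    by (simp add: ennreal_plus ennreal_mult)
  also have "\<dots> \<le> 4 * (ennreal (D * D) * conditionality_const smul y m) + 3 * conditionality_const smul y m"
    by (intro add_mono mult_left_mono M_le one) auto
  also have "\<dots> = (4 * ennreal (D * D) + 3) * conditionality_const smul y m"
    by (simp only: distrib_right mult.assoc)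
  also have "4 * ennreal (D * D) + 3 = ennreal (4 * (D * D) + 3)"
    by (simp add: ennreal_plus ennreal_mult)
  finally show "ennreal (ln (real m)) \<le> ennreal (4 * (D * D) + 3) * conditionality_const smul y m" .
qed

end

theorem theorem3p1:
  fixes smul :: "'k::{real_normed_field, euclidean_space} \<Rightarrow> 'a::banach \<Rightarrow> 'a"
  assumes "normed_space_over smul"
    and "\<exists>x. schauder_basis smul x"
    and "\<exists>Y. complemented_subspace smul Y \<and> ell1_isomorphic smul Y"
  shows "\<exists>x. schauder_basis smul x \<and> almost_greedy smul x \<and>
    equivalent_on {1..} (fundamental_function x) (\<lambda>m. of_nat m) \<and>
    equivalent_on {2..} (conditionality_const smul x) (\<lambda>m. ennreal (ln (real m)))"
proof -
  interpret banach_space_over smul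
    using assms(1) by (simp add: banach_space_over_def)
  obtain x Y where x: "schauder_basis smul x"
    and Y: "complemented_subspace smul Y" "ell1_isomorphic smul Y"
    using assms(2,3) by blast
  obtain u t K0 where "K0 > 0" "ell1_functionals t K0" "\<And>n. norm (u n) \<le> K0"
    "\<And>n m. t n (u m) = (if n = m then 1 else 0)"
    by (rule complemented_ell1_basis[OF Y]) (rule that; assumption)
  then obtain v0 vs0 e0 es0 K1 where "basis_ell1_system smul v0 vs0 e0 es0 UNIV K1"
    by (rule basis_ell1_system_exists[OF x]) (rule that; assumption)
  \<comment> \<open>The unit vectors at the block starts become the difference basis. This vacates
    exactly the indices at which the block construction wants \<open>e\<close> to vanish.\<close>
  then obtain v vs e es K where sys: "basis_ell1_system smul v vs e es (- range block_start) K"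
    and v: "\<And>M. norm (\<Sum>m<M. v (2 * m)) \<le> K" "\<And>M. real M \<le> K * norm (\<Sum>m<M. v (4 * m))"
    by (rule difference_system_exists[OF _ strict_mono_block_start]) (rule that; assumption)
  interpret blocked_system smul v vs e es K
    using sys by (simp add: blocked_system_def)
  show ?thesis
    using schauder_basis_y almost_greedy_y fundamental_function_y conditionality_const_y[OF v] by blast
qed

end
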